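(* Let $\mathcal D$ be the generic poset and let $\mathcal X\subseteq\operatorname{Aut}(\mathcal D)$ be the set of all correctly orbitally incomparable automorphisms of $\mathcal D$. Then: (i) the set $$\{(f,g)\in\mathcal X\times\operatorname{Aut}(\mathcal D): f\text{ and }g\text{ freely generate a dense subgroup of }\operatorname{Aut}(\mathcal D)\}$$ is comeager in $\mathcal X\times\operatorname{Aut}(\mathcal D)$; (ii) for every natural number $m\ge 1$, the set of cyclically dense elements $\bar g\in\operatorname{Aut}(\mathcal D)^m$ for the diagonal action is comeager in $\operatorname{Aut}(\mathcal D)^m$.
   Context: The generic poset $\mathcal D$ is the Fraïssé limit of the class of all finite posets, i.e. the unique (up to isomorphism) countable poset such that for every finite subposet $X\subseteq\mathcal D$ and every one-point extension $X\cup\{x\}$ (a poset whose order restricted to $X$ is the original one) there are $y\in\mathcal D$ and an isomorphism $X\cup\{x\}\to X\cup\{y\}$ extending the identity on $X$. We write $x\perp y$ if neither $x\le y$ nor $y\le x$. An automorphism $f\in\operatorname{Aut}(\mathcal D)$ is orbitally incomparable if $f^k(x)\perp x$ for every $x\in\mathcal D$ and $k\in\mathbb Z\setminus\{0\}$. It is correctly orbitally incomparable if it is orbitally incomparable and the relation on the orbits $[x]=\{f^k(x):k\in\mathbb Z\}$ given by $[x]\preceq[y]\iff x'\le y'$ for some $x'\in[x]$, $y'\in[y]$ is a partial order. $\operatorname{Aut}(\mathcal D)$ carries the topology with basic open sets $\{\bar f: f\subset\bar f\}$, $f$ an isomorphism between finite subposets; products and subspaces have the product and subspace topologies. For a topological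 group $G$, $\bar g=(g_1,\dots,g_m)\in G^m$ is cyclically dense for the diagonal action of $G$ on $G^m$ if for some $f\in G$ the set $\{(f^kg_1f^{-k},\dots,f^kg_mf^{-k}):k\in\mathbb Z\}$ is dense in $G^m$. Comeager means complement of a countable union of nowhere dense sets. "$f$ and $g$ freely generate a dense subgroup" means that $w(f,g)\ne\operatorname{id}$ for every irreducible word $w(a,b)$ (an expression $c_1^{n_1}\cdots c_k^{n_k}$, $k\ge1$, $c_i\in\{a,b\}$, $n_i\in\mathbb Z\setminus\{0\}$, $c_i\neq c_{i+1}$) and $\langle f,g\rangle$ is dense. *)

theory Defs
  imports
    "HOL-Analysis.Function_Topology"
    "HOL-Analysis.Product_Topology"
    "HOL-Algebra.Generated_Groups"
begin

section \<open>Posets and the generic poset\<close>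

definition poset_on :: "'a set \<Rightarrow> ('a \<Rightarrow> 'a \<Rightarrow> bool) \<Rightarrow> bool" where
  "poset_on A R \<longleftrightarrow> reflp_on A R \<and> antisymp_on A R \<and> transp_on A R"

definition poset_iso ::
  "'a set \<Rightarrow> ('a \<Rightarrow> 'a \<Rightarrow> bool) \<Rightarrow> 'b set \<Rightarrow> ('b \<Rightarrow> 'b \<Rightarrow> bool) \<Rightarrow> ('a \<Rightarrow> 'b) \<Rightarrow> bool" where
  "poset_iso A R B S h \<longleftrightarrow> bij_betw h A B \<and> (\<forall>x\<in>A. \<forall>y\<in>A. R x y \<longleftrightarrow> S (h x) (h y))"

text \<open>
  The poset is a whole type of class \<open>order\<close>. A one-point extension of \<open>X\<close> lives on
  \<open>Some ` X \<union> {None}\<close>: \<open>Some\<close> is the inclusion of \<open>X\<close> and \<open>None\<close> is the new point.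
\<close>
definition generic_poset :: "'a::order itself \<Rightarrow> bool" where
  "generic_poset (_ :: 'a itself) \<longleftrightarrow>
     countable (UNIV :: 'a set) \<and>
     (\<forall>(X :: 'a set) R.
        finite X \<and> poset_on (insert None (Some ` X)) R \<and>
        (\<forall>a\<in>X. \<forall>b\<in>X. R (Some a) (Some b) \<longleftrightarrow> a \<le> b) \<longrightarrow>
        (\<exists>y h. poset_iso (insert None (Some ` X)) R (insert y X) (\<le>) h \<and>
               (\<forall>a\<in>X. h (Some a) = a)))"

definition incomparable :: "'a::order \<Rightarrow> 'a \<Rightarrow> bool" where
  "incomparable x y \<longleftrightarrow> \<not> x \<le> y \<and> \<not> y \<le> x"


section \<open>The topological group of automorphisms\<close>

definition Aut :: "('a::order \<Rightarrow> 'a) monoid" where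
  "Aut = \<lparr>carrier = {f. poset_iso UNIV (\<le>) UNIV (\<le>) f}, mult = (\<circ>), one = id\<rparr>"

lemma group_Aut: "group (Aut :: ('a::order \<Rightarrow> 'a) monoid)"
proof (rule groupI)
  fix f :: "'a \<Rightarrow> 'a"
  assume f: "f \<in> carrier Aut"
  then have b: "bij f" and le: "\<And>x y. x \<le> y \<longleftrightarrow> f x \<le> f y"
    by (auto simp: Aut_def poset_iso_def)
  have "inv_into UNIV f \<in> carrier Aut"
    using bij_imp_bij_inv[OF b] le[of "inv_into UNIV f _" "inv_into UNIV f _"]
      surj_f_inv_f[OF bij_is_surj[OF b]]
    by (simp add: Aut_def poset_iso_def)
  moreover have "inv_into UNIV f \<circ> f = id"
    using b by (simp add: bij_is_inj)
  ultimately show "\<exists>g\<in>carrier Aut. g \<otimes>\<^bsub>Aut\<^esub> f = \<one>\<^bsub>Aut\<^esub>"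
    by (auto simp: Aut_def)
qed (auto simp: Aut_def poset_iso_def bij_comp comp_assoc)

text \<open>
  The sets below together with the empty set are closed under binary intersection, so they
  form a basis (not merely a subbasis) of the generated topology.
\<close>
definition Aut_topology :: "('a::order \<Rightarrow> 'a) topology" where
  "Aut_topology = topology_generated_by
     {{f \<in> carrier Aut. \<forall>x\<in>X. f x = p x} | X Y p.
        finite X \<and> finite Y \<and> poset_iso X (\<le>) Y (\<le>) p}"

lemma topspace_Aut_topology: "topspace Aut_topology = carrier Aut"
proof -
  have "poset_iso {} (\<le>) {} (\<le>) id"
    by (simp add: poset_iso_def)
  then show ?thesis
    unfolding Aut_topology_def topology_generated_by_topspace by blast
qed


section \<open>Orbitally incomparable automorphisms\<close>

definition Z_orbit :: "('a::order \<Rightarrow> 'a) \<Rightarrow> 'a \<Rightarrow> 'a set" where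
  "Z_orbit f x = {(f [^]\<^bsub>Aut\<^esub> (k::int)) x | k. True}"

definition orbitally_incomparable :: "('a::order \<Rightarrow> 'a) \<Rightarrow> bool" where
  "orbitally_incomparable f \<longleftrightarrow>
     f \<in> carrier Aut \<and> (\<forall>x (k::int). k \<noteq> 0 \<longrightarrow> incomparable ((f [^]\<^bsub>Aut\<^esub> k) x) x)"

definition orbit_le :: "'a::order set \<Rightarrow> 'a set \<Rightarrow> bool" where
  "orbit_le P Q \<longleftrightarrow> (\<exists>x\<in>P. \<exists>y\<in>Q. x \<le> y)"

definition correctly_orbitally_incomparable :: "('a::order \<Rightarrow> 'a) \<Rightarrow> bool" where
  "correctly_orbitally_incomparable f \<longleftrightarrow>
     orbitally_incomparable f \<and> poset_on (range (Z_orbit f)) orbit_le"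


section \<open>Comeager sets\<close>

definition nowhere_dense_in :: "'a topology \<Rightarrow> 'a set \<Rightarrow> bool" where
  "nowhere_dense_in T A \<longleftrightarrow> A \<subseteq> topspace T \<and> T interior_of (T closure_of A) = {}"

definition comeager_in :: "'a topology \<Rightarrow> 'a set \<Rightarrow> bool" where
  "comeager_in T S \<longleftrightarrow>
     S \<subseteq> topspace T \<and>
     (\<exists>\<N>. countable \<N> \<and> (\<forall>N\<in>\<N>. nowhere_dense_in T N) \<and> topspace T - S = \<Union>\<N>)"


section \<open>Free dense generation and cyclic density\<close>

datatype letter = Letter_a | Letter_b

text \<open>The list \<open>[(c\<^sub>1, n\<^sub>1), \<dots>, (c\<^sub>k, n\<^sub>k)]\<close> stands for the word with syllables \<open>c\<^sub>i\<close> to the power \<open>n\<^sub>i\<close>.\<close>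
definition irreducible_word :: "(letter \<times> int) list \<Rightarrow> bool" where
  "irreducible_word w \<longleftrightarrow>
     w \<noteq> [] \<and> (\<forall>(c, n)\<in>set w. n \<noteq> 0) \<and> distinct_adj (map fst w)"

primrec letter_value :: "'g \<Rightarrow> 'g \<Rightarrow> letter \<Rightarrow> 'g" where
  "letter_value f g Letter_a = f"
| "letter_value f g Letter_b = g"

definition word_value :: "('g, 'x) monoid_scheme \<Rightarrow> 'g \<Rightarrow> 'g \<Rightarrow> (letter \<times> int) list \<Rightarrow> 'g" where
  "word_value G f g w =
     foldr (\<lambda>(c, n) u. (letter_value f g c [^]\<^bsub>G\<^esub> n) \<otimes>\<^bsub>G\<^esub> u) w \<one>\<^bsub>G\<^esub>"

definition freely_generate_dense_subgroup ::
  "('g, 'x) monoid_scheme \<Rightarrow> 'g topology \<Rightarrow> 'g \<Rightarrow> 'g \<Rightarrow> bool" where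
  "freely_generate_dense_subgroup G T f g \<longleftrightarrow>
     (\<forall>w. irreducible_word w \<longrightarrow> word_value G f g w \<noteq> \<one>\<^bsub>G\<^esub>) \<and>
     T closure_of (generate G {f, g}) = topspace T"

definition tuple_topology :: "nat \<Rightarrow> 'g topology \<Rightarrow> (nat \<Rightarrow> 'g) topology" where
  "tuple_topology m T = product_topology (\<lambda>_. T) {..<m}"

definition cyclically_dense ::
  "('g, 'x) monoid_scheme \<Rightarrow> 'g topology \<Rightarrow> nat \<Rightarrow> (nat \<Rightarrow> 'g) \<Rightarrow> bool" where
  "cyclically_dense G T m gs \<longleftrightarrow>
     gs \<in> {..<m} \<rightarrow>\<^sub>E carrier G \<and>
     (\<exists>f\<in>carrier G.
        tuple_topology m T closure_of
          range (\<lambda>k::int. \<lambda>i\<in>{..<m}. f [^]\<^bsub>G\<^esub> k \<otimes>\<^bsub>G\<^esub> gs i \<otimes>\<^bsub>G\<^esub> f [^]\<^bsub>G\<^esub> (- k))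
        = topspace (tuple_topology m T))"

end

theory Submission
  imports Defs
begin


text \<open>
  Both halves of the theorem rest on one kind of automorphism. Call \<open>f\<close> dispersing if for all \<open>x\<close>, \<open>y\<close>
  only finitely many powers satisfy \<open>f\<^sup>k x \<le> y\<close>. Then every finite set \<open>B\<close> is moved off itself by some power
  of \<open>f\<close>, in the strong sense that all points of \<open>f\<^sup>k B\<close> are incomparable to all points of \<open>B\<close>. Given \<open>g\<close>
  prescribed on a finite set and a target \<open>h\<close> prescribed on another, the finite map consisting of \<open>g\<close> and of the
  copy of \<open>h\<close> transported by \<open>f\<^sup>k\<close> is therefore a partial isomorphism: its two parts do not interact. It extends
  to an automorphism \<open>g'\<close> by homogeneity, and conjugating \<open>g'\<close> by \<open>f\<^sup>k\<close> agrees with \<open>h\<close>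
  where prescribed (\<open>extend_with_conjugate\<close>). Since this works for finitely many pairs \<open>(g, h)\<close> with the same \<open>k\<close>, a fixed
  dispersing \<open>f\<close> witnesses cyclic density of a comeager set of tuples: there is one dense open condition for
  each of the countably many finite targets.

  For the pairs \<open>(f, g)\<close> the automorphism \<open>f\<close> varies over the correctly orbitally incomparable ones, so one
  needs that the dispersing ones are dense among them (\<open>dispersing_approximation\<close>). Keep only finitely many
  orbits of \<open>f\<close>, and among the order relations between them only those generated by the translates of finitely
  many. Correctness of \<open>f\<close> makes the orbits a finite poset, along which the generated order can be built one
  orbit at a time; only finitely many translates of a point then lie below a given point. This structure is a
  poset on finitely many copies of \<open>\<int>\<close>, invariant under the shift. Further orbits are adjoined freely, one for
  each prescription of finitely many lower and upper bounds, until the poset is generic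
  (\<open>shift_poset_generic_extension\<close>). A back-and-forth isomorphism onto the given generic poset that respects
  the finite part turns the shift into the required dispersing automorphism.

  Freeness is obtained by changing \<open>g\<close> alone. For an irreducible word \<open>w\<close> and any orbitally incomparable \<open>f\<close> one follows the
  letters of \<open>w\<close> along a path of pairwise incomparable points: each \<open>g\<close>-step goes to a fresh point that is,
  together with its \<open>f\<close>-translates, incomparable to everything seen before. Maps between antichains are
  partial isomorphisms, so \<open>g\<close> can be modified to follow the path, whose end differs from its start
  (\<open>generic_word_nontrivial\<close>).
\<close>
section \<open>Shift-invariant posets on copies of the integers\<close>

definition shift :: "int \<Rightarrow> nat \<times> int \<Rightarrow> nat \<times> int" where
  "shift k p = (fst p, snd p + k)"

lemma fst_shift [simp]: "fst (shift k p) = fst p"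
  and snd_shift [simp]: "snd (shift k p) = snd p + k"
  and shift_shift [simp]: "shift j (shift k p) = shift (j + k) p"
  and shift_0 [simp]: "shift 0 p = p"
  by (simp_all add: shift_def)

lemma shift_eq_iff [simp]: "shift j p = shift k p \<longleftrightarrow> j = k"
  by (simp add: shift_def)

text \<open>
  The set \<open>I \<times> \<int>\<close> with the shift is a free action of \<open>\<int>\<close> with one orbit for each element of \<open>I\<close>. The assumptions
  \<open>orbit_antichain\<close> and \<open>orbit_antisym\<close> say that the shift is correctly orbitally incomparable, and
  \<open>locally_finite\<close> that it is dispersing. The relation is false outside \<open>I \<times> \<int>\<close>.
\<close>
locale shift_poset =
  fixes I :: "nat set" and R :: "nat \<times> int \<Rightarrow> nat \<times> int \<Rightarrow> bool"
  assumes support: "R p q \<Longrightarrow> fst p \<in> I \<and> fst q \<in> I"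
    and refl: "fst p \<in> I \<Longrightarrow> R p p"
    and trans: "R p q \<Longrightarrow> R q r \<Longrightarrow> R p r"
    and shift_mono: "R p q \<Longrightarrow> R (shift k p) (shift k q)"
    and orbit_antichain: "R p q \<Longrightarrow> fst p = fst q \<Longrightarrow> p = q"
    and orbit_antisym:
      "R p q \<Longrightarrow> R q' p' \<Longrightarrow> fst p' = fst p \<Longrightarrow> fst q' = fst q \<Longrightarrow> fst p = fst q"
    and locally_finite: "finite {k. R p (shift k q)}"
begin

lemma shift_iff: "R (shift j p) (shift k q) \<longleftrightarrow> R p (shift (k - j) q)"
  using shift_mono[of "shift j p" "shift k q" "- j"] shift_mono[of p "shift (k - j) q" j]
  by auto

lemma antisym: "R p q \<Longrightarrow> R q p \<Longrightarrow> p = q"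
  using orbit_antisym orbit_antichain by blast

lemma finite_shift_diff: "finite {k. R p (shift (j + k) q)}"
  using finite_vimageI[OF locally_finite[of p q], of "\<lambda>k. j + k"]
  by (simp add: vimage_def inj_def)

end

lemma shift_poset_empty: "shift_poset {} (\<lambda>_ _. False)"
  by unfold_locales auto

text \<open>
  Adds an orbit \<open>{n} \<times> \<int>\<close> whose point \<open>(n, 0)\<close> has exactly the lower bounds generated by \<open>L\<close> and the upper
  bounds generated by \<open>U\<close>; the bounds of the other points of the orbit are the translates.
\<close>
definition adjoin ::
  "nat \<Rightarrow> (nat \<times> int) set \<Rightarrow> (nat \<times> int) set \<Rightarrow> (nat \<times> int \<Rightarrow> nat \<times> int \<Rightarrow> bool) \<Rightarrow>
     nat \<times> int \<Rightarrow> nat \<times> int \<Rightarrow> bool" where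
  "adjoin n L U R p q \<longleftrightarrow> R p q \<or> p = q \<and> fst p = n \<or>
     fst q = n \<and> (\<exists>l\<in>L. R p (shift (snd q) l)) \<or>
     fst p = n \<and> (\<exists>u\<in>U. R (shift (snd p) u) q)"

context shift_poset
begin

lemma adjoin_old:
  assumes "n \<notin> I" "fst p \<noteq> n" "fst q \<noteq> n"
  shows "adjoin n L U R p q \<longleftrightarrow> R p q"
  using assms by (auto simp: adjoin_def)

lemma adjoin_below:
  assumes "n \<notin> I" "fst p \<noteq> n" "fst q = n"
  shows "adjoin n L U R p q \<longleftrightarrow> (\<exists>l\<in>L. R p (shift (snd q) l))"
  using assms support[of p q] by (auto simp: adjoin_def)

lemma adjoin_above:
  assumes "n \<notin> I" "fst p = n" "fst q \<noteq> n"
  shows "adjoin n L U R p q \<longleftrightarrow> (\<exists>u\<in>U. R (shift (snd p) u) q)"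
  using assms support[of p q] by (auto simp: adjoin_def)

text \<open>
  The only way in which the new orbit could spoil the structure is a chain that leaves the orbit upwards and
  comes back to it from below. Such a chain runs from a translate of some \<open>u \<in> U\<close> to a translate of some
  \<open>l \<in> L\<close>; since \<open>l\<close> lies below \<open>u\<close>, antisymmetry on orbits forces \<open>l = u\<close>, contrary to disjointness.
\<close>
lemma shift_poset_adjoin:
  assumes n: "n \<notin> I" and fin: "finite L" "finite U"
    and LU: "\<And>l u. l \<in> L \<Longrightarrow> u \<in> U \<Longrightarrow> R l u" and disj: "L \<inter> U = {}"
  shows "shift_poset (insert n I) (adjoin n L U R)"
proof -
  let ?R = "adjoin n L U R"
  have sup: "fst p \<noteq> n" "fst q \<noteq> n" if "R p q" for p q
    using support[OF that] n by auto
  have no_loop: False if "l \<in> L" "u \<in> U" "R (shift i u) q" "R q' (shift j l)" "fst q' = fst q"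
    for l u i j q q'
  proof -
    \<comment> \<open>Translating the first half of the chain makes its end meet the start of the second half.\<close>
    have "R (shift (i - snd q + snd q') u) q'"
      using shift_mono[OF that(3), of "snd q' - snd q"] that(5) by (cases q') (simp add: shift_def algebra_simps)
    from trans[OF this that(4)] have "R (shift (i - snd q + snd q') u) (shift j l)" .
    with LU[OF that(1,2)] have "fst l = fst u" "l = u"
      using orbit_antisym[of l u "shift (i - snd q + snd q') u" "shift j l"] orbit_antichain by auto
    with that disj show False by auto
  qed
  have new: "?R p q \<Longrightarrow> fst p = n \<Longrightarrow> fst q = n \<Longrightarrow> p = q" for p q
    using sup unfolding adjoin_def by blast
  note old = adjoin_old[OF n] and below = adjoin_below[OF n] and above = adjoin_above[OF n]
  show ?thesis
  proof
    fix p q assume "?R p q"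
    then show "fst p \<in> insert n I \<and> fst q \<in> insert n I"
      unfolding adjoin_def by (auto dest: support)
  next
    fix p :: "nat \<times> int" assume "fst p \<in> insert n I" then show "?R p p"
      using refl[of p] by (auto simp: adjoin_def)
  next
    fix p q r assume pq: "?R p q" and qr: "?R q r"
    show "?R p r"
    proof (cases "fst q = n")
      case q: True
      consider "p = q" | "r = q" | "fst p \<noteq> n" "fst r \<noteq> n"
        using new[OF pq] new[OF qr] q by metis
      then show ?thesis
      proof cases
        case 3
        then obtain l u where "l \<in> L" "R p (shift (snd q) l)" "u \<in> U" "R (shift (snd q) u) r"
          using pq qr q below[of p q L U] above[of q r L U] by auto
        then have "R p r"
          using trans[OF trans[OF _ shift_mono[OF LU]]] by blast
        then show ?thesis by (simp add: adjoin_def)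
      qed (use pq qr in auto)
    next
      case q: False
      show ?thesis
      proof (cases "fst p = n"; cases "fst r = n")
        assume "fst p \<noteq> n" "fst r \<noteq> n"
        then show ?thesis
          using pq qr q old[of p q L U] old[of q r L U] old[of p r L U] trans[of p q r] by auto
      next
        assume "fst p \<noteq> n" "fst r = n"
        then show ?thesis
          using pq qr q old[of p q L U] below[of q r L U] below[of p r L U] trans[of p q] by blast
      next
        assume "fst p = n" "fst r \<noteq> n"
        then show ?thesis
          using pq qr q above[of p q L U] old[of q r L U] above[of p r L U] trans[of _ q r] by blast
      next
        assume "fst p = n" "fst r = n"
        then obtain l u where "u \<in> U" "R (shift (snd p) u) q" "l \<in> L" "R q (shift (snd r) l)"
          using pq qr q above[of p q L U] below[of q r L U] by auto
        then show ?thesis using no_loop by blast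
      qed
    qed
  next
    fix p q k assume "?R p q"
    moreover have "R (shift k p) (shift (snd q + k) l)" if "R p (shift (snd q) l)" for l
      using shift_mono[OF that, of k] by (simp add: add.commute)
    moreover have "R (shift (snd p + k) u) (shift k q)" if "R (shift (snd p) u) q" for u
      using shift_mono[OF that, of k] by (simp add: add.commute)
    ultimately show "?R (shift k p) (shift k q)"
      unfolding adjoin_def fst_shift snd_shift using shift_mono[of p q k] by blast
  next
    fix p q assume "?R p q" "fst p = fst q"
    then show "p = q"
      using new[of p q] old[of p q L U] orbit_antichain[of p q] by (cases "fst p = n") metis+
  next
    fix p q p' q' assume 1: "?R p q" "?R q' p'" and eq: "fst p' = fst p" "fst q' = fst q"
    show "fst p = fst q"
    proof (rule ccontr)
      assume neq: "fst p \<noteq> fst q"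
      consider "fst p \<noteq> n" "fst q \<noteq> n" | "fst p = n" "fst q \<noteq> n" | "fst p \<noteq> n" "fst q = n"
        using neq by auto
      then show False
      proof cases
        case 1
        then show False
          using \<open>?R p q\<close> \<open>?R q' p'\<close> eq neq old[of p q L U] old[of q' p' L U]
            orbit_antisym[of p q q' p'] by auto
      next
        case 2
        then obtain l u where "u \<in> U" "R (shift (snd p) u) q" "l \<in> L" "R q' (shift (snd p') l)"
          using 1 eq above[of p q L U] below[of q' p' L U] by auto
        then show False using no_loop eq by blast
      next
        case 3
        then obtain l u where "u \<in> U" "R (shift (snd q') u) p'" "l \<in> L" "R p (shift (snd q) l)"
          using 1 eq above[of q' p' L U] below[of p q L U] by auto
        then show False using no_loop eq by metis
      qed
    qed
  next
    fix p q
    have "{k. ?R p (shift k q)} \<subseteq> {k. R p (shift k q)} \<union> {snd p - snd q} \<union>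
       (\<Union>l\<in>L. {k. R p (shift (snd q + k) l)}) \<union> (\<Union>u\<in>U. {k. R (shift (snd p) u) (shift k q)})"
      by (auto simp: adjoin_def)
    moreover have "finite ({k. R p (shift k q)} \<union> {snd p - snd q} \<union>
       (\<Union>l\<in>L. {k. R p (shift (snd q + k) l)}) \<union> (\<Union>u\<in>U. {k. R (shift (snd p) u) (shift k q)}))"
      using locally_finite finite_shift_diff fin by auto
    ultimately show "finite {k. ?R p (shift k q)}"
      by (rule finite_subset)
  qed
qed

end

text \<open>
  The one-point extension property in terms of bounds: \<open>L\<close>, \<open>U\<close> and \<open>N\<close> are the points that are to lie below,
  above and off the new point. The new point is required to differ from all of them.
\<close>
definition extension_property :: "('a \<Rightarrow> 'a \<Rightarrow> bool) \<Rightarrow> bool" where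
  "extension_property R \<longleftrightarrow>
     (\<forall>L U N. finite L \<and> finite U \<and> finite N \<and> L \<inter> U = {} \<and>
        (\<forall>l\<in>L. \<forall>u\<in>U. R l u) \<and> (\<forall>n\<in>N. (\<forall>l\<in>L. \<not> R n l) \<and> (\<forall>u\<in>U. \<not> R u n)) \<longrightarrow>
        (\<exists>y. (\<forall>l\<in>L. R l y \<and> \<not> R y l) \<and> (\<forall>u\<in>U. R y u \<and> \<not> R u y) \<and>
             (\<forall>n\<in>N. \<not> R n y \<and> \<not> R y n)))"

text \<open>
  Every task recurs, so that it is also met after all the orbits that it mentions have been built.
\<close>
lemma exists_task_enumeration:
  "\<exists>task :: nat \<Rightarrow> 'b::countable. \<forall>t N. \<exists>n\<ge>N. task n = t"
proof (rule exI[of _ "\<lambda>n. snd (from_nat n :: nat \<times> 'b)"], intro allI)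
  fix t :: 'b and N :: nat
  have "infinite (range (\<lambda>k::nat. to_nat (k, t)))"
    by (intro range_inj_infinite) (simp add: inj_def)
  then obtain n where "N < n" "n \<in> range (\<lambda>k::nat. to_nat (k, t))"
    unfolding infinite_nat_iff_unbounded by blast
  then obtain k :: nat where "N < to_nat (k, t)"
    by auto
  then show "\<exists>n\<ge>N. snd (from_nat n :: nat \<times> 'b) = t"
    by (intro exI[of _ "to_nat (k, t)"]) simp
qed

text \<open>
  Stage \<open>n\<close> adjoins orbit \<open>n0 + n\<close> with the lower and upper bounds that the \<open>n\<close>-th task asks for, and with no
  bounds when the task is not consistent at that stage. The union of the stages has the extension
  property, because a point whose only lower bounds are those generated by \<open>L\<close> is above no point of \<open>N\<close>,
  and dually for \<open>U\<close>.
\<close>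
lemma shift_poset_generic_extension:
  assumes S: "shift_poset {..<n0} S"
  obtains R where "shift_poset UNIV R" "extension_property R"
    "\<And>p q. fst p < n0 \<Longrightarrow> fst q < n0 \<Longrightarrow> R p q \<longleftrightarrow> S p q"
proof -
  obtain task :: "nat \<Rightarrow> (nat \<times> int) list \<times> (nat \<times> int) list"
    where task: "\<And>t N. \<exists>n\<ge>N. task n = t"
    using exists_task_enumeration by metis
  define L where "L n = set (fst (task n))" for n
  define U where "U n = set (snd (task n))" for n
  define realises where "realises n R R' \<longleftrightarrow>
    ((\<forall>l\<in>L n. \<forall>u\<in>U n. R l u) \<and> L n \<inter> U n = {} \<longrightarrow>
      (\<forall>p. fst p < n0 + n \<longrightarrow> (R' p (n0 + n, 0) \<longleftrightarrow> (\<exists>l\<in>L n. R p l)) \<and>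
                              (R' (n0 + n, 0) p \<longleftrightarrow> (\<exists>u\<in>U n. R u p))))" for n R R'
  have "\<exists>f. \<forall>n. (shift_poset {..<n0 + n} (f n) \<and> (n = 0 \<longrightarrow> f n = S)) \<and>
    ((\<forall>p q. fst p < n0 + n \<longrightarrow> fst q < n0 + n \<longrightarrow> (f (Suc n) p q \<longleftrightarrow> f n p q)) \<and>
         realises n (f n) (f (Suc n)))"
  proof (rule dependent_nat_choice)
    show "\<exists>R. shift_poset {..<n0 + 0} R \<and> (0 = 0 \<longrightarrow> R = S)"
      using S by simp
  next
    fix R n assume "shift_poset {..<n0 + n} R \<and> (n = 0 \<longrightarrow> R = S)"
    then interpret shift_poset "{..<n0 + n}" R by simp
    let ?valid = "(\<forall>l\<in>L n. \<forall>u\<in>U n. R l u) \<and> L n \<inter> U n = {}"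
    define L' where "L' = (if ?valid then L n else {})"
    define U' where "U' = (if ?valid then U n else {})"
    have "shift_poset (insert (n0 + n) {..<n0 + n}) (adjoin (n0 + n) L' U' R)"
      by (rule shift_poset_adjoin) (auto simp: L'_def U'_def L_def U_def split: if_splits)
    moreover have "insert (n0 + n) {..<n0 + n} = {..<n0 + Suc n}"
      by auto
    moreover have "realises n R (adjoin (n0 + n) L' U' R)"
      unfolding realises_def
    proof (intro impI allI)
      fix p :: "nat \<times> int"
      assume "?valid" and p: "fst p < n0 + n"
      then have "L' = L n" "U' = U n"
        by (simp_all add: L'_def U'_def)
      with p show "(adjoin (n0 + n) L' U' R p (n0 + n, 0) \<longleftrightarrow> (\<exists>l\<in>L n. R p l)) \<and>
          (adjoin (n0 + n) L' U' R (n0 + n, 0) p \<longleftrightarrow> (\<exists>u\<in>U n. R u p))"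
        using adjoin_below[of "n0 + n" p "(n0 + n, 0)" L' U'] adjoin_above[of "n0 + n" "(n0 + n, 0)" p L' U']
        by simp
    qed
    ultimately show "\<exists>R'. (shift_poset {..<n0 + Suc n} R' \<and> (Suc n = 0 \<longrightarrow> R' = S)) \<and>
      (\<forall>p q. fst p < n0 + n \<longrightarrow> fst q < n0 + n \<longrightarrow> (R' p q \<longleftrightarrow> R p q)) \<and> realises n R R'"
      using adjoin_old[of "n0 + n" _ _ L' U'] by (intro exI[of _ "adjoin (n0 + n) L' U' R"]) simp
  qed
  then obtain Rs where *: "\<forall>n. (shift_poset {..<n0 + n} (Rs n) \<and> (n = 0 \<longrightarrow> Rs n = S)) \<and>
    ((\<forall>p q. fst p < n0 + n \<longrightarrow> fst q < n0 + n \<longrightarrow> (Rs (Suc n) p q \<longleftrightarrow> Rs n p q)) \<and>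
         realises n (Rs n) (Rs (Suc n)))"
    by (rule exE)
  have Rs: "shift_poset {..<n0 + n} (Rs n)" and real: "realises n (Rs n) (Rs (Suc n))" for n
    using * by blast+
  have Rs_Suc: "Rs (Suc n) p q \<longleftrightarrow> Rs n p q" if "fst p < n0 + n" "fst q < n0 + n" for n p q
    using that * by blast
  have Rs0: "Rs 0 = S"
    using * by blast
  \<comment> \<open>Later stages do not change the relation between old points, so each stage is the restriction of the union.\<close>
  have Rs_le: "Rs m p q \<longleftrightarrow> Rs n p q" if "n \<le> m" "fst p < n0 + n" "fst q < n0 + n" for m n p q
    using that
  proof (induction m rule: dec_induct)
    case (step m)
    then show ?case using Rs_Suc[of p m q] by auto
  qed simp
  define R where "R p q \<longleftrightarrow> (\<exists>n. Rs n p q)" for p q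
  have R_iff: "R p q \<longleftrightarrow> Rs n p q" if "fst p < n0 + n" "fst q < n0 + n" for n p q
  proof -
    have "Rs n p q" if *: "Rs m p q" for m
    proof (cases "n \<le> m")
      case True
      then show ?thesis using Rs_le[OF True] \<open>fst p < n0 + n\<close> \<open>fst q < n0 + n\<close> * by blast
    next
      case False
      moreover have "fst p < n0 + m" "fst q < n0 + m"
        using shift_poset.support[OF Rs *] by auto
      ultimately show ?thesis using Rs_le[of m n p q] * by simp
    qed
    then show ?thesis unfolding R_def by blast
  qed
  show ?thesis
  proof
    show sp: "shift_poset UNIV R"
    proof
      fix p show "R p p"
        using shift_poset.refl[OF Rs, of p "fst p + 1"] by (auto simp: R_def)
    next
      fix p q r assume "R p q" "R q r"
      then have "Rs (fst p + fst q + fst r + 1) p q" "Rs (fst p + fst q + fst r + 1) q r"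
        using R_iff[of p "fst p + fst q + fst r + 1" q] R_iff[of q "fst p + fst q + fst r + 1" r]
        by auto
      then show "R p r"
        unfolding R_def using shift_poset.trans[OF Rs] by blast
    next
      fix p q k assume "R p q" then show "R (shift k p) (shift k q)"
        unfolding R_def using shift_poset.shift_mono[OF Rs] by blast
    next
      fix p q assume "R p q" "fst p = fst q" then show "p = q"
        unfolding R_def using shift_poset.orbit_antichain[OF Rs] by blast
    next
      fix p q p' q' assume "R p q" "R q' p'" "fst p' = fst p" "fst q' = fst q"
      then have "Rs (fst p + fst q + 1) p q" "Rs (fst p + fst q + 1) q' p'"
        using R_iff[of p "fst p + fst q + 1" q] R_iff[of q' "fst p + fst q + 1" p'] by auto
      then show "fst p = fst q"
        using shift_poset.orbit_antisym[OF Rs] \<open>fst p' = fst p\<close> \<open>fst q' = fst q\<close> by blast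
    next
      fix p q
      have "{k. R p (shift k q)} = {k. Rs (fst p + fst q + 1) p (shift k q)}"
        using R_iff[of p "fst p + fst q + 1" "shift _ q"] by auto
      then show "finite {k. R p (shift k q)}"
        using shift_poset.locally_finite[OF Rs] by simp
    qed simp
    then interpret shift_poset UNIV R .
    show "extension_property R"
      unfolding extension_property_def
    proof (intro allI impI, elim conjE)
      fix A B N :: "(nat \<times> int) set"
      assume fin: "finite A" "finite B" "finite N" and disj: "A \<inter> B = {}"
        and AB: "\<forall>l\<in>A. \<forall>u\<in>B. R l u"
        and N: "\<forall>n\<in>N. (\<forall>l\<in>A. \<not> R n l) \<and> (\<forall>u\<in>B. \<not> R u n)"
      \<comment> \<open>The task is carried out at a stage where the orbits of \<open>A\<close>, \<open>B\<close> and \<open>N\<close> are all present.\<close>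
      obtain M where M: "\<And>p. p \<in> A \<union> B \<union> N \<Longrightarrow> fst p < M"
        using fin finite_nat_set_iff_bounded[of "fst ` (A \<union> B \<union> N)"] by auto
      obtain as bs where lists: "set as = A" "set bs = B"
        using fin finite_list by metis
      obtain n where n: "M \<le> n" "task n = (as, bs)"
        using task by blast
      let ?y = "(n0 + n, 0::int)"
      have LU: "L n = A" "U n = B"
        using n lists by (auto simp: L_def U_def)
      have old: "Rs n p q \<longleftrightarrow> R p q" if "p \<in> A \<union> B \<union> N" "q \<in> A \<union> B \<union> N" for p q
        using R_iff[of p n q] M[OF that(1)] M[OF that(2)] n(1) by auto
      have valid: "(\<forall>l\<in>L n. \<forall>u\<in>U n. Rs n l u) \<and> L n \<inter> U n = {}"
        using AB disj old unfolding LU by blast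
      have new: "R p ?y \<longleftrightarrow> (\<exists>l\<in>A. R p l)" "R ?y p \<longleftrightarrow> (\<exists>u\<in>B. R u p)"
        if p: "p \<in> A \<union> B \<union> N" for p
      proof -
        have lt: "fst p < n0 + n"
          using M[OF p] n(1) by simp
        have "R p ?y \<longleftrightarrow> Rs (Suc n) p ?y" "R ?y p \<longleftrightarrow> Rs (Suc n) ?y p"
          using lt by (auto intro!: R_iff)
        moreover have "Rs (Suc n) p ?y \<longleftrightarrow> (\<exists>l\<in>A. Rs n p l)" "Rs (Suc n) ?y p \<longleftrightarrow> (\<exists>u\<in>B. Rs n u p)"
          using real[of n] valid lt unfolding realises_def LU by blast+
        ultimately show "R p ?y \<longleftrightarrow> (\<exists>l\<in>A. R p l)" "R ?y p \<longleftrightarrow> (\<exists>u\<in>B. R u p)"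
          using old p by blast+
      qed
      have "\<not> (R l u \<and> R u l)" if "l \<in> A" "u \<in> B" for l u
        using antisym that disj by blast
      then have "(\<forall>l\<in>A. R l ?y \<and> \<not> R ?y l) \<and> (\<forall>u\<in>B. R ?y u \<and> \<not> R u ?y)"
        using new AB refl[OF UNIV_I] by blast
      moreover have "\<forall>n\<in>N. \<not> R n ?y \<and> \<not> R ?y n"
        using new N by blast
      ultimately have "(\<forall>l\<in>A. R l ?y \<and> \<not> R ?y l) \<and> (\<forall>u\<in>B. R ?y u \<and> \<not> R u ?y) \<and>
             (\<forall>n\<in>N. \<not> R n ?y \<and> \<not> R ?y n)"
        by blast
      then show "\<exists>y. (\<forall>l\<in>A. R l y \<and> \<not> R y l) \<and> (\<forall>u\<in>B. R y u \<and> \<not> R u y) \<and>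
             (\<forall>n\<in>N. \<not> R n y \<and> \<not> R y n)" ..
    qed
  next
    fix p q :: "nat \<times> int" assume "fst p < n0" "fst q < n0"
    then show "R p q \<longleftrightarrow> S p q" using R_iff[of p 0 q] Rs0 by simp
  qed
qed


section \<open>Back and forth\<close>

text \<open>
  Partial maps are relations here, which makes the roles of the two posets symmetric. Between posets the
  condition already forces the relation to be single-valued and injective.
\<close>
definition partial_iso :: "('a \<Rightarrow> 'a \<Rightarrow> bool) \<Rightarrow> ('b \<Rightarrow> 'b \<Rightarrow> bool) \<Rightarrow> ('a \<times> 'b) set \<Rightarrow> bool" where
  "partial_iso R S p \<longleftrightarrow> (\<forall>(a, b)\<in>p. \<forall>(a', b')\<in>p. R a a' \<longleftrightarrow> S b b')"

lemma partial_isoD: "partial_iso R S p \<Longrightarrow> (a, b) \<in> p \<Longrightarrow> (a', b') \<in> p \<Longrightarrow> R a a' \<longleftrightarrow> S b b'"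
  unfolding partial_iso_def by fast

lemma partial_iso_converse: "partial_iso S R (p\<inverse>) \<longleftrightarrow> partial_iso R S p"
  unfolding partial_iso_def by fast

lemma poset_on_UNIV:
  "poset_on UNIV R \<longleftrightarrow> (\<forall>x. R x x) \<and> (\<forall>x y. R x y \<longrightarrow> R y x \<longrightarrow> x = y) \<and>
     (\<forall>x y z. R x y \<longrightarrow> R y z \<longrightarrow> R x z)"
  unfolding poset_on_def reflp_on_def antisymp_on_def transp_on_def by blast

text \<open>
  The points of the range split into the images of points below, above and off \<open>x\<close>; the extension property
  yields a point in the same position.
\<close>
lemma partial_iso_extend_domain:
  assumes R: "poset_on UNIV R" and S: "poset_on UNIV S" and ext: "extension_property S"
    and fin: "finite p" and p: "partial_iso R S p"
  shows "\<exists>y. partial_iso R S (insert (x, y) p)"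
proof (cases "x \<in> Domain p")
  case True
  then obtain y where "(x, y) \<in> p" by blast
  then show ?thesis using p insert_absorb by metis
next
  case x: False
  note refl = R[unfolded poset_on_UNIV, THEN conjunct1, rule_format]
    S[unfolded poset_on_UNIV, THEN conjunct1, rule_format]
  have antisym: "R a b \<Longrightarrow> R b a \<Longrightarrow> a = b" and trans: "R a b \<Longrightarrow> R b c \<Longrightarrow> R a c" for a b c
    using R unfolding poset_on_UNIV by blast+
  note pD = partial_isoD[OF p]
  define L where "L = {b. \<exists>a. (a, b) \<in> p \<and> R a x}"
  define U where "U = {b. \<exists>a. (a, b) \<in> p \<and> R x a}"
  define N where "N = {b. \<exists>a. (a, b) \<in> p \<and> \<not> R a x \<and> \<not> R x a}"
  have inj: "a = a'" if "(a, b) \<in> p" "(a', b) \<in> p" for a a' b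
    using that pD refl antisym by blast
  have "L \<subseteq> Range p" "U \<subseteq> Range p" "N \<subseteq> Range p"
    by (auto simp: L_def U_def N_def)
  then have "finite L \<and> finite U \<and> finite N"
    using finite_Range[OF fin] finite_subset by metis
  moreover have "L \<inter> U = {}"
    using inj antisym x unfolding L_def U_def by blast
  moreover have "\<forall>l\<in>L. \<forall>u\<in>U. S l u"
    using pD trans unfolding L_def U_def by blast
  moreover have "\<forall>n\<in>N. (\<forall>l\<in>L. \<not> S n l) \<and> (\<forall>u\<in>U. \<not> S u n)"
    using pD trans unfolding L_def U_def N_def by blast
  ultimately obtain y where L: "\<forall>l\<in>L. S l y \<and> \<not> S y l" and U: "\<forall>u\<in>U. S y u \<and> \<not> S u y"
    and N: "\<forall>n\<in>N. \<not> S n y \<and> \<not> S y n"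
    using ext[unfolded extension_property_def, rule_format, of L U N] by blast
  have "(R a x \<longleftrightarrow> S b y) \<and> (R x a \<longleftrightarrow> S y b)" if ab: "(a, b) \<in> p" for a b
  proof -
    have "\<not> (R a x \<and> R x a)"
      using ab x antisym by blast
    then consider "b \<in> L" "R a x" "\<not> R x a" | "b \<in> U" "R x a" "\<not> R a x" | "b \<in> N" "\<not> R x a" "\<not> R a x"
      using ab unfolding L_def U_def N_def by blast
    then show ?thesis
      using L U N by cases blast+
  qed
  then have "partial_iso R S (insert (x, y) p)"
    using p refl unfolding partial_iso_def by auto
  then show ?thesis ..
qed

lemma partial_iso_extend_range:
  assumes "poset_on UNIV R" "poset_on UNIV S" "extension_property R" "finite p" "partial_iso R S p"
  shows "\<exists>x. partial_iso R S (insert (x, y) p)"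
proof -
  have "\<exists>x. partial_iso S R (insert (y, x) (p\<inverse>))"
    using assms by (intro partial_iso_extend_domain) (auto simp: partial_iso_converse)
  moreover have "insert (y, x) (p\<inverse>) = (insert (x, y) p)\<inverse>" for x
    by auto
  ultimately show ?thesis by (simp add: partial_iso_converse)
qed

lemma back_and_forth:
  fixes R :: "'a \<Rightarrow> 'a \<Rightarrow> bool" and S :: "'b \<Rightarrow> 'b \<Rightarrow> bool"
  assumes R: "poset_on UNIV R" "extension_property R" "countable (UNIV :: 'a set)"
    and S: "poset_on UNIV S" "extension_property S" "countable (UNIV :: 'b set)"
    and p: "finite p" "partial_iso R S p"
  obtains h where "bij h" "\<And>x y. R x y \<longleftrightarrow> S (h x) (h y)" "\<And>a b. (a, b) \<in> p \<Longrightarrow> h a = b"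
proof -
  define e where "e = from_nat_into (UNIV :: 'a set)"
  define e' where "e' = from_nat_into (UNIV :: 'b set)"
  have surj: "\<exists>n. e n = x" "\<exists>n. e' n = y" for x y
    using from_nat_into_surj[OF R(3), of x] from_nat_into_surj[OF S(3), of y]
    by (auto simp: e_def e'_def)
  have "\<exists>f. \<forall>n. (finite (f n) \<and> partial_iso R S (f n) \<and> p \<subseteq> f n) \<and>
          (f n \<subseteq> f (Suc n) \<and> e n \<in> Domain (f (Suc n)) \<and> e' n \<in> Range (f (Suc n)))"
  proof (rule dependent_nat_choice)
    show "\<exists>q. finite q \<and> partial_iso R S q \<and> p \<subseteq> q"
      using p by blast
  next
    fix q n assume q: "finite q \<and> partial_iso R S q \<and> p \<subseteq> q"
    then obtain y where y: "partial_iso R S (insert (e n, y) q)"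
      using partial_iso_extend_domain[OF R(1) S(1,2)] by blast
    with q obtain x where "partial_iso R S (insert (x, e' n) (insert (e n, y) q))"
      using partial_iso_extend_range[OF R(1) S(1) R(2), of "insert (e n, y) q" "e' n"] by auto
    with q show "\<exists>q'. (finite q' \<and> partial_iso R S q' \<and> p \<subseteq> q') \<and>
        (q \<subseteq> q' \<and> e n \<in> Domain q' \<and> e' n \<in> Range q')"
      by (intro exI[of _ "insert (x, e' n) (insert (e n, y) q)"]) auto
  qed
  then obtain f where f: "\<forall>n. (finite (f n) \<and> partial_iso R S (f n) \<and> p \<subseteq> f n) \<and>
          (f n \<subseteq> f (Suc n) \<and> e n \<in> Domain (f (Suc n)) \<and> e' n \<in> Range (f (Suc n)))"
    by (rule exE)
  define H where "H = (\<Union>n. f n)"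
  have mono: "f m \<subseteq> f n" if "m \<le> n" for m n
    by (rule lift_Suc_mono_le[of f, OF _ that]) (use f in blast)
  have H: "R a a' \<longleftrightarrow> S b b'" if ab: "(a, b) \<in> H" "(a', b') \<in> H" for a a' b b'
  proof -
    obtain m n where "(a, b) \<in> f m" "(a', b') \<in> f n"
      using ab unfolding H_def by blast
    then have "(a, b) \<in> f (max m n)" "(a', b') \<in> f (max m n)"
      using mono[of m "max m n"] mono[of n "max m n"] by auto
    then show ?thesis using f partial_isoD by metis
  qed
  have eq: "a = a' \<longleftrightarrow> b = b'" if ab: "(a, b) \<in> H" "(a', b') \<in> H" for a a' b b'
    using H[OF ab] H[OF ab(2,1)] R(1) S(1) unfolding poset_on_UNIV by metis
  have total: "\<exists>y. (x, y) \<in> H" and onto: "\<exists>x. (x, y) \<in> H" for x y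
  proof -
    obtain m n where "e m = x" "e' n = y"
      using surj by blast
    moreover have "e m \<in> Domain (f (Suc m))" "e' n \<in> Range (f (Suc n))"
      using f by blast+
    ultimately show "\<exists>y. (x, y) \<in> H" "\<exists>x. (x, y) \<in> H"
      unfolding H_def by blast+
  qed
  define h where "h x = (SOME y. (x, y) \<in> H)" for x
  have h: "(x, h x) \<in> H" for x
    unfolding h_def using total someI_ex by fast
  show ?thesis
  proof
    show "bij h"
    proof (rule bijI)
      show "inj h"
        using h eq unfolding inj_def by metis
      show "surj h"
        using h eq onto unfolding surj_def by metis
    qed
    show "R x y \<longleftrightarrow> S (h x) (h y)" for x y
      using H h by blast
    show "h a = b" if "(a, b) \<in> p" for a b
    proof -
      have "(a, b) \<in> H" using that f unfolding H_def by blast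
      then show ?thesis using eq h by blast
    qed
  qed
qed

lemma poset_on_order: "poset_on UNIV ((\<le>) :: 'a::order \<Rightarrow> 'a \<Rightarrow> bool)"
  by (auto simp: poset_on_UNIV)

text \<open>
  The new point is placed above everything that is below some point of \<open>L\<close> and below everything that is above
  some point of \<open>U\<close>, which makes transitivity immediate. By the assumptions this relates it to no point of
  \<open>N\<close>, and puts no point on both sides of it.
\<close>
lemma generic_poset_extension_property:
  assumes "generic_poset TYPE('a::order)"
  shows "extension_property ((\<le>) :: 'a \<Rightarrow> 'a \<Rightarrow> bool)"
  unfolding extension_property_def
proof (intro allI impI, elim conjE)
  fix L U N :: "'a set"
  assume fin: "finite L" "finite U" "finite N" and disj: "L \<inter> U = {}"
    and LU: "\<forall>l\<in>L. \<forall>u\<in>U. l \<le> u" and N: "\<forall>n\<in>N. (\<forall>l\<in>L. \<not> n \<le> l) \<and> (\<forall>u\<in>U. \<not> u \<le> n)"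
  let ?X = "L \<union> U \<union> N"
  define below where "below a \<longleftrightarrow> (\<exists>l\<in>L. a \<le> l)" for a
  define above where "above a \<longleftrightarrow> (\<exists>u\<in>U. u \<le> a)" for a
  define R where "R s t = (case s of
      None \<Rightarrow> (case t of None \<Rightarrow> True | Some b \<Rightarrow> above b)
    | Some a \<Rightarrow> (case t of None \<Rightarrow> below a | Some b \<Rightarrow> a \<le> b))" for s t
  have R_simps: "R None None" "R None (Some b) \<longleftrightarrow> above b"
    "R (Some a) None \<longleftrightarrow> below a" "R (Some a) (Some b) \<longleftrightarrow> a \<le> b" for a b
    by (simp_all add: R_def)
  have no_loop: "\<not> below a" if above: "above a" for a
  proof
    assume "below a"
    then obtain l u where lu: "l \<in> L" "u \<in> U" "u \<le> a" "a \<le> l"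
      using above unfolding below_def above_def by blast
    moreover from this have "l = u"
      using LU by (meson order.antisym order.trans)
    ultimately show False using disj by blast
  qed
  have below_trans: "below a" if "a \<le> b" "below b" for a b
    using that order.trans unfolding below_def by blast
  have above_trans: "above c" if "above b" "b \<le> c" for b c
    using that order.trans unfolding above_def by blast
  have below_above: "a \<le> c" if "below a" "above c" for a c
    using that LU unfolding below_def above_def by (meson order.trans)
  have "poset_on (insert None (Some ` ?X)) R"
    unfolding poset_on_def
  proof (intro conjI)
    show "reflp_on (insert None (Some ` ?X)) R"
      by (auto simp: reflp_on_def R_simps)
    show "antisymp_on (insert None (Some ` ?X)) R"
    proof (rule antisymp_onI)
      fix s t assume "R s t" "R t s"
      then show "s = t"
        using no_loop by (cases s; cases t) (auto simp: R_simps)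
    qed
    show "transp_on (insert None (Some ` ?X)) R"
    proof (rule transp_onI)
      fix s t r assume "R s t" "R t r"
      then show "R s r"
        using no_loop
        by (cases s; cases t; cases r)
          (auto simp: R_simps intro: below_above dest: below_trans above_trans)
    qed
  qed
  moreover have "\<forall>a\<in>?X. \<forall>b\<in>?X. R (Some a) (Some b) \<longleftrightarrow> a \<le> b"
    by (simp add: R_simps)
  moreover have "finite ?X"
    using fin by simp
  ultimately obtain y h where iso: "poset_iso (insert None (Some ` ?X)) R (insert y ?X) (\<le>) h"
    and h: "\<forall>a\<in>?X. h (Some a) = a"
    using assms[unfolded generic_poset_def, THEN conjunct2, rule_format, of ?X R] by blast
  have hN: "h None = y"
  proof -
    have inj: "inj_on h (insert None (Some ` ?X))" and im: "h ` insert None (Some ` ?X) = insert y ?X"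
      using iso by (auto simp: poset_iso_def bij_betw_def)
    have "h None \<notin> ?X"
    proof
      assume "h None \<in> ?X"
      then have "h (Some (h None)) = h None" "Some (h None) \<in> insert None (Some ` ?X)"
        using h by blast+
      then show False
        using inj_onD[OF inj, of "Some (h None)" None] by simp
    qed
    then show ?thesis using im by blast
  qed
  have y: "a \<le> y \<longleftrightarrow> below a" "y \<le> a \<longleftrightarrow> above a" if "a \<in> ?X" for a
  proof -
    have "R (Some a) None \<longleftrightarrow> h (Some a) \<le> h None" "R None (Some a) \<longleftrightarrow> h None \<le> h (Some a)"
      using iso that unfolding poset_iso_def by blast+
    then show "a \<le> y \<longleftrightarrow> below a" "y \<le> a \<longleftrightarrow> above a"
      using that h hN R_simps by auto
  qed
  have belowL: "below l" if "l \<in> L" for l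
    using that unfolding below_def by blast
  have aboveU: "above u" if "u \<in> U" for u
    using that unfolding above_def by blast
  have "(\<forall>l\<in>L. l \<le> y \<and> \<not> y \<le> l) \<and> (\<forall>u\<in>U. y \<le> u \<and> \<not> u \<le> y)"
    using y belowL aboveU no_loop by blast
  moreover have "\<forall>n\<in>N. \<not> n \<le> y \<and> \<not> y \<le> n"
    using y N unfolding below_def above_def by blast
  ultimately have "(\<forall>l\<in>L. l \<le> y \<and> \<not> y \<le> l) \<and> (\<forall>u\<in>U. y \<le> u \<and> \<not> u \<le> y) \<and>
      (\<forall>n\<in>N. \<not> n \<le> y \<and> \<not> y \<le> n)" by blast
  then show "\<exists>y. (\<forall>l\<in>L. l \<le> y \<and> \<not> y \<le> l) \<and> (\<forall>u\<in>U. y \<le> u \<and> \<not> u \<le> y) \<and> (\<forall>n\<in>N. \<not> n \<le> y \<and> \<not> y \<le> n)" ..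
qed


section \<open>Powers of automorphisms and their orbits\<close>

interpretation Aut: group "Aut :: ('a::order \<Rightarrow> 'a) monoid"
  by (rule group_Aut)

lemma mem_Aut_iff: "f \<in> carrier Aut \<longleftrightarrow> bij f \<and> (\<forall>x y. x \<le> y \<longleftrightarrow> f x \<le> f y)"
  by (simp add: Aut_def poset_iso_def)

lemma Aut_mult [simp]: "f \<otimes>\<^bsub>Aut\<^esub> g = f \<circ> g"
  and Aut_one [simp]: "\<one>\<^bsub>Aut\<^esub> = id"
  by (simp_all add: Aut_def)

lemma Aut_le_iff: "f \<in> carrier Aut \<Longrightarrow> f x \<le> f y \<longleftrightarrow> x \<le> y"
  by (simp add: mem_Aut_iff)

lemma Aut_eq_iff: "f \<in> carrier Aut \<Longrightarrow> f x = f y \<longleftrightarrow> x = y"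
  by (simp add: mem_Aut_iff bij_is_inj inj_eq)

lemma Aut_pow_0: "(f [^]\<^bsub>Aut\<^esub> (0::int)) x = x"
  by simp

lemma Aut_pow_1: "f \<in> carrier Aut \<Longrightarrow> f [^]\<^bsub>Aut\<^esub> (1::int) = f"
  by simp

lemma Aut_pow_add:
  "f \<in> carrier Aut \<Longrightarrow> (f [^]\<^bsub>Aut\<^esub> (j + k :: int)) x = (f [^]\<^bsub>Aut\<^esub> j) ((f [^]\<^bsub>Aut\<^esub> k) x)"
  using Aut.int_pow_mult[of f j k] by simp

lemma Aut_pow_minus:
  assumes "f \<in> carrier Aut"
  shows "(f [^]\<^bsub>Aut\<^esub> (- k :: int)) ((f [^]\<^bsub>Aut\<^esub> k) x) = x"
    "(f [^]\<^bsub>Aut\<^esub> k) ((f [^]\<^bsub>Aut\<^esub> (- k :: int)) x) = x"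
  using Aut_pow_add[OF assms, of "- k" k x] Aut_pow_add[OF assms, of k "- k" x] by simp_all

lemma Aut_pow_le_iff:
  "f \<in> carrier Aut \<Longrightarrow> (f [^]\<^bsub>Aut\<^esub> (k::int)) x \<le> (f [^]\<^bsub>Aut\<^esub> k) y \<longleftrightarrow> x \<le> y"
  by (rule Aut_le_iff) simp

lemma Aut_pow_le_shift:
  assumes "f \<in> carrier Aut"
  shows "(f [^]\<^bsub>Aut\<^esub> j) x \<le> (f [^]\<^bsub>Aut\<^esub> (k::int)) y \<longleftrightarrow> (f [^]\<^bsub>Aut\<^esub> (j - k)) x \<le> y"
  using Aut_pow_le_iff[OF assms, of k "(f [^]\<^bsub>Aut\<^esub> (j - k)) x" y]
    Aut_pow_add[OF assms, of k "j - k" x] by simp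

text \<open>
  A map that intertwines the shift with \<open>f\<close> identifies the powers of \<open>f\<close> with the translations.
\<close>
lemma Aut_pow_shift:
  assumes f: "f \<in> carrier Aut" and h: "\<And>p. f (h p) = h (shift 1 p)"
  shows "(f [^]\<^bsub>Aut\<^esub> (k::int)) (h p) = h (shift k p)"
proof (induction k arbitrary: p rule: int_induct[of _ 0])
  case base
  then show ?case by simp
next
  case (step1 i)
  then show ?case
    using Aut_pow_add[OF f, of i 1 "h p"] Aut_pow_1[OF f] h by simp
next
  case (step2 i)
  have "(f [^]\<^bsub>Aut\<^esub> (i - 1)) (f (h (shift (- 1) p))) = h (shift (i - 1) p)"
    using step2(2)[of "shift (- 1) p"] Aut_pow_add[OF f, of "i - 1" 1 "h (shift (- 1) p)"] Aut_pow_1[OF f]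
    by simp
  then show ?case using h[of "shift (- 1) p"] by simp
qed

lemma orbits_are_antichains:
  assumes f: "correctly_orbitally_incomparable f" and le: "(f [^]\<^bsub>Aut\<^esub> j) x \<le> (f [^]\<^bsub>Aut\<^esub> (k::int)) x"
  shows "j = k"
proof -
  have "f \<in> carrier Aut" "j - k \<noteq> 0 \<Longrightarrow> \<not> (f [^]\<^bsub>Aut\<^esub> (j - k)) x \<le> x"
    using f by (auto simp: correctly_orbitally_incomparable_def orbitally_incomparable_def incomparable_def)
  with le show ?thesis
    using Aut_pow_le_shift[of f j x k x] by auto
qed

text \<open>
  Both inequalities put the orbits of \<open>x\<close> and \<open>y\<close> below each other, so the orbits coincide.
\<close>
lemma orbit_preorder_antisym:
  assumes f: "correctly_orbitally_incomparable f"
    and le: "(f [^]\<^bsub>Aut\<^esub> (i::int)) x \<le> y" "(f [^]\<^bsub>Aut\<^esub> (j::int)) y \<le> x"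
  shows "\<exists>k::int. (f [^]\<^bsub>Aut\<^esub> k) x = y"
proof -
  have self: "x \<in> Z_orbit f x" for x
    unfolding Z_orbit_def using Aut_pow_0[of f x, symmetric] by blast
  have "orbit_le (Z_orbit f x) (Z_orbit f y)" "orbit_le (Z_orbit f y) (Z_orbit f x)"
    using le self unfolding orbit_le_def Z_orbit_def by blast+
  moreover have "antisymp_on (range (Z_orbit f)) orbit_le"
    using f by (simp add: correctly_orbitally_incomparable_def poset_on_def)
  ultimately have "Z_orbit f x = Z_orbit f y"
    by (auto dest: antisymp_onD)
  then have "y \<in> Z_orbit f x"
    using self[of y] by simp
  then show ?thesis
    unfolding Z_orbit_def by auto
qed

section \<open>Dispersing automorphisms\<close>

definition dispersing :: "('a::order \<Rightarrow> 'a) \<Rightarrow> bool" where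
  "dispersing f \<longleftrightarrow> f \<in> carrier Aut \<and> (\<forall>x y. finite {k::int. (f [^]\<^bsub>Aut\<^esub> k) x \<le> y})"

text \<open>
  The axioms of a shift-invariant poset are what correct orbital incomparability and dispersion of the shift
  amount to; the isomorphism \<open>h\<close> carries them over to the conjugate of the shift.
\<close>
lemma shift_conjugate:
  fixes h :: "nat \<times> int \<Rightarrow> 'a::order"
  assumes R: "shift_poset UNIV R" and h: "bij h" "\<And>p q. R p q \<longleftrightarrow> h p \<le> h q"
  obtains f where "correctly_orbitally_incomparable f" "dispersing f" "\<And>p. f (h p) = h (shift 1 p)"
proof -
  interpret shift_poset UNIV R by (rule R)
  define f where "f = h \<circ> shift 1 \<circ> inv_into UNIV h"
  have fh: "f (h p) = h (shift 1 p)" for p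
    using h(1) by (simp add: f_def bij_is_inj)
  have "bij (shift 1)"
    by (rule o_bij[of "shift (- 1)"]) (auto simp: fun_eq_iff)
  then have "bij f"
    unfolding f_def using h(1) by (intro bij_comp bij_imp_bij_inv)
  have ex: "\<exists>p. x = h p" for x
    using h(1) by (metis bij_pointE)
  have "x \<le> y \<longleftrightarrow> f x \<le> f y" for x y
  proof -
    obtain p q where "x = h p" "y = h q"
      using ex by blast
    then show ?thesis
      using h(2) fh shift_iff[of 1 p 1 q] by simp
  qed
  with \<open>bij f\<close> have f: "f \<in> carrier Aut"
    by (simp add: mem_Aut_iff)
  note pow = Aut_pow_shift[of f h, OF f fh]
  have pow_le: "(f [^]\<^bsub>Aut\<^esub> (k::int)) (h p) \<le> h q \<longleftrightarrow> R (shift k p) q" for k p q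
    using pow h(2) by simp
  have "finite {k::int. (f [^]\<^bsub>Aut\<^esub> k) x \<le> y}" for x y
  proof -
    obtain p q where "x = h p" "y = h q"
      using ex by blast
    then have "{k. (f [^]\<^bsub>Aut\<^esub> k) x \<le> y} = uminus ` {k. R p (shift k q)}"
      using pow_le shift_iff[of _ p 0 q] by (auto simp: image_iff) (metis add.inverse_inverse)
    then show ?thesis
      using locally_finite by simp
  qed
  with f have "dispersing f"
    by (simp add: dispersing_def)
  have antichain: "\<not> (f [^]\<^bsub>Aut\<^esub> k) x \<le> x" if "k \<noteq> 0" for k :: int and x
  proof -
    obtain p where "x = h p"
      using ex by blast
    then show ?thesis
      using pow_le[of k p p] orbit_antichain[of "shift k p" p] shift_eq_iff[of k p 0] that by auto
  qed
  have "incomparable ((f [^]\<^bsub>Aut\<^esub> k) x) x" if "k \<noteq> 0" for k :: int and x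
    using antichain[OF that] antichain[of "- k"] that Aut_pow_le_shift[OF f, of 0 x k x]
    by (simp add: incomparable_def)
  with f have oi: "orbitally_incomparable f"
    by (simp add: orbitally_incomparable_def)
  have same_orbit: "(\<exists>k. q = shift k p) \<longleftrightarrow> fst q = fst p" for p q
    by (auto simp: shift_def prod_eq_iff intro: exI[of _ "snd q - snd p"])
  have orbit: "Z_orbit f (h p) = {h q | q. fst q = fst p}" for p
    unfolding Z_orbit_def pow same_orbit[symmetric] by blast
  have orbit_le: "orbit_le (Z_orbit f (h p)) (Z_orbit f (h q)) \<longleftrightarrow>
      (\<exists>p' q'. fst p' = fst p \<and> fst q' = fst q \<and> R p' q')" for p q
    unfolding orbit_le_def orbit using h(2) by blast
  have orbit_eq: "Z_orbit f (h p) = Z_orbit f (h q)" if "fst p = fst q" for p q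
    unfolding orbit that ..
  have rng: "range (Z_orbit f) = range (\<lambda>p. Z_orbit f (h p))"
    using image_image[of "Z_orbit f" h UNIV] bij_is_surj[OF h(1)] by simp
  have "poset_on (range (Z_orbit f)) orbit_le"
    unfolding poset_on_def rng
  proof (intro conjI)
    show "reflp_on (range (\<lambda>p. Z_orbit f (h p))) orbit_le"
      using refl by (auto simp: reflp_on_def orbit_le)
    show "antisymp_on (range (\<lambda>p. Z_orbit f (h p))) orbit_le"
    proof (rule antisymp_onI, elim rangeE)
      fix P Q p q assume eq: "P = Z_orbit f (h p)" "Q = Z_orbit f (h q)" and "orbit_le P Q" "orbit_le Q P"
      then obtain p' q' p'' q'' where *: "fst p' = fst p" "fst q' = fst q" "R p' q'"
        "fst p'' = fst p" "fst q'' = fst q" "R q'' p''"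
        unfolding eq orbit_le by blast
      then have "fst p = fst q"
        using orbit_antisym[of p' q' q'' p''] by simp
      then show "P = Q"
        unfolding eq by (rule orbit_eq)
    qed
    show "transp_on (range (\<lambda>p. Z_orbit f (h p))) orbit_le"
    proof (rule transp_onI, elim rangeE)
      fix P Q S p q s
      assume eq: "P = Z_orbit f (h p)" "Q = Z_orbit f (h q)" "S = Z_orbit f (h s)"
        and "orbit_le P Q" "orbit_le Q S"
      then obtain p' q' q'' s'' where *: "fst p' = fst p" "fst q' = fst q" "R p' q'"
        "fst q'' = fst q" "fst s'' = fst s" "R q'' s''"
        unfolding eq orbit_le by blast
      have "shift (snd q'' - snd q') q' = q''"
        using * by (simp add: shift_def prod_eq_iff)
      then have "R (shift (snd q'' - snd q') p') s''"
        using shift_mono[OF *(3), of "snd q'' - snd q'"] trans[OF _ *(6)] by simp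
      then show "orbit_le P S"
        unfolding eq orbit_le using * by (intro exI[of _ "shift (snd q'' - snd q') p'"] exI[of _ s'']) simp
    qed
  qed
  with oi have "correctly_orbitally_incomparable f"
    by (simp add: correctly_orbitally_incomparable_def)
  then show ?thesis
    using \<open>dispersing f\<close> fh that by blast
qed

text \<open>
  Genericity of the extended shift-invariant poset gives the isomorphism, and back-and-forth lets it start
  with the finite map \<open>p\<close>. This is how the values of the automorphism at finitely many points are
  controlled.
\<close>
lemma realise_shift_poset:
  fixes p :: "((nat \<times> int) \<times> 'a::order) set"
  assumes gen: "generic_poset TYPE('a)" and S: "shift_poset {..<n} S"
    and p: "finite p" "partial_iso S (\<le>) p" "\<And>q a. (q, a) \<in> p \<Longrightarrow> fst q < n"
  obtains f :: "'a \<Rightarrow> 'a" where "correctly_orbitally_incomparable f" "dispersing f"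
    "\<And>q a b. (q, a) \<in> p \<Longrightarrow> (shift 1 q, b) \<in> p \<Longrightarrow> f a = b"
proof -
  obtain R where R: "shift_poset UNIV R" "extension_property R"
    and RS: "\<And>p q. fst p < n \<Longrightarrow> fst q < n \<Longrightarrow> R p q \<longleftrightarrow> S p q"
    using shift_poset_generic_extension[OF S] by blast
  interpret shift_poset UNIV R by (rule R)
  have "poset_on UNIV R"
    unfolding poset_on_UNIV using refl antisym trans by blast
  moreover have "R q q' \<longleftrightarrow> a \<le> a'" if "(q, a) \<in> p" "(q', a') \<in> p" for q a q' a'
    using partial_isoD[OF p(2) that] RS p(3)[OF that(1)] p(3)[OF that(2)] by simp
  then have "partial_iso R (\<le>) p"
    unfolding partial_iso_def by blast
  moreover have "countable (UNIV :: 'a set)"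
    using gen by (simp add: generic_poset_def)
  ultimately obtain h where h: "bij h" "\<And>x y. R x y \<longleftrightarrow> h x \<le> h y" "\<And>q a. (q, a) \<in> p \<Longrightarrow> h q = a"
    using back_and_forth[of R "(\<le>) :: 'a \<Rightarrow> 'a \<Rightarrow> bool" p] R(2) poset_on_order
      generic_poset_extension_property[OF gen] p(1) by auto
  obtain f where "correctly_orbitally_incomparable f" "dispersing f" "\<And>p. f (h p) = h (shift 1 p)"
    using shift_conjugate[OF R(1) h(1,2)] by blast
  with h(3) show ?thesis
    using that by metis
qed

lemma exists_dispersing:
  assumes "generic_poset TYPE('a::order)"
  shows "\<exists>f :: 'a \<Rightarrow> 'a. dispersing f"
proof -
  have "shift_poset {..<0} (\<lambda>_ _. False)"
    using shift_poset_empty by simp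
  then show ?thesis
    using realise_shift_poset[OF assms, of 0 _ "{}"] by (auto simp: partial_iso_def)
qed

text \<open>
  A linear extension of the order on the finitely many orbits that meet \<open>B\<close>: no orbit lies below an earlier
  one. The last orbit is that of a maximal point with respect to "some power of \<open>f\<close> moves \<open>x\<close> below \<open>y\<close>"; the
  points that are equivalent to it under this preorder lie in its orbit, by correctness.
\<close>
lemma orbit_representatives:
  assumes f: "correctly_orbitally_incomparable f" and "finite B"
  shows "\<exists>(n::nat) r. r ` {..<n} \<subseteq> B \<and> (\<forall>i j. i < j \<and> j < n \<longrightarrow> (\<forall>k::int. \<not> (f [^]\<^bsub>Aut\<^esub> k) (r j) \<le> r i)) \<and>
    (\<forall>b\<in>B. \<exists>i<n. \<exists>k::int. (f [^]\<^bsub>Aut\<^esub> k) (r i) = b)"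
  using \<open>finite B\<close>
proof (induction B rule: finite_psubset_induct)
  case (psubset B)
  have fA: "f \<in> carrier Aut"
    using f by (simp add: correctly_orbitally_incomparable_def orbitally_incomparable_def)
  define above where "above x = {c \<in> B. \<exists>k::int. (f [^]\<^bsub>Aut\<^esub> k) x \<le> c}" for x
  have refl: "x \<in> above x" if "x \<in> B" for x
  proof -
    have "(f [^]\<^bsub>Aut\<^esub> (0::int)) x \<le> x"
      by simp
    with that show ?thesis unfolding above_def by blast
  qed
  have mono: "above c \<subseteq> above b" if bc: "c \<in> above b" for b c
  proof
    fix d assume "d \<in> above c"
    then obtain j k :: int where "d \<in> B" "(f [^]\<^bsub>Aut\<^esub> k) c \<le> d" "(f [^]\<^bsub>Aut\<^esub> j) b \<le> c"
      using bc unfolding above_def by blast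
    moreover from this have "(f [^]\<^bsub>Aut\<^esub> (k + j)) b \<le> (f [^]\<^bsub>Aut\<^esub> k) c"
      using Aut_pow_add[OF fA] Aut_pow_le_iff[OF fA] by simp
    ultimately have "d \<in> B" "(f [^]\<^bsub>Aut\<^esub> (k + j)) b \<le> d"
      by auto
    then show "d \<in> above b" unfolding above_def by blast
  qed
  show ?case
  proof (cases "B = {}")
    case True
    then show ?thesis by auto
  next
    case False
    \<comment> \<open>Enlarging a point in the preorder shrinks the set above it, so a smallest such set belongs to a maximal point.\<close>
    then obtain b where b: "b \<in> B" and min: "\<And>c. c \<in> B \<Longrightarrow> card (above b) \<le> card (above c)"
      using ex_has_least_nat[of "\<lambda>b. b \<in> B" _ "\<lambda>b. card (above b)"] by blast
    have max: "b \<in> above c" if "c \<in> above b" for c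
    proof -
      have "finite (above b)" "c \<in> B"
        using psubset(1) that by (auto simp: above_def)
      then have "above c = above b"
        using mono[OF that] min by (metis card_seteq)
      then show ?thesis using refl b by simp
    qed
    have "B - above b \<subset> B"
      using b refl by blast
    from psubset(2)[OF this] obtain n :: nat and r where r: "r ` {..<n} \<subseteq> B - above b"
      "\<forall>i j. i < j \<and> j < n \<longrightarrow> (\<forall>k::int. \<not> (f [^]\<^bsub>Aut\<^esub> k) (r j) \<le> r i)"
      "\<forall>b\<in>B - above b. \<exists>i<n. \<exists>k::int. (f [^]\<^bsub>Aut\<^esub> k) (r i) = b"
      by blast
    let ?r = "r(n := b)"
    have "?r i \<in> B" if "i < Suc n" for i
      using that r(1) b by (cases "i = n") (auto simp: image_subset_iff)
    then have "?r ` {..<Suc n} \<subseteq> B"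
      by blast
    moreover have "\<not> (f [^]\<^bsub>Aut\<^esub> k) (?r j) \<le> ?r i" if "i < j" "j < Suc n" for i j and k :: int
    proof (cases "j = n")
      case True
      with that r(1) have "r i \<in> B - above b" "i \<noteq> n" by auto
      then show ?thesis using True unfolding above_def by auto
    next
      case False
      then show ?thesis using that r(2) by auto
    qed
    moreover have "\<exists>i<Suc n. \<exists>k::int. (f [^]\<^bsub>Aut\<^esub> k) (?r i) = c" if c: "c \<in> B" for c
    proof (cases "c \<in> above b")
      case True
      then obtain j k :: int where "(f [^]\<^bsub>Aut\<^esub> j) b \<le> c" "(f [^]\<^bsub>Aut\<^esub> k) c \<le> b"
        using max unfolding above_def by blast
      then obtain l :: int where "(f [^]\<^bsub>Aut\<^esub> l) b = c"
        using orbit_preorder_antisym[OF f] by blast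
      then show ?thesis by (intro exI[of _ n]) auto
    next
      case False
      then obtain i k where "i < n" "(f [^]\<^bsub>Aut\<^esub> (k::int)) (r i) = c"
        using r(3) c by blast
      then show ?thesis by (intro exI[of _ i]) auto
    qed
    ultimately show ?thesis by (intro exI[of _ "Suc n"] exI[of _ ?r]) blast
  qed
qed

text \<open>
  On \<open>B = A \<union> f ` A\<close> the old order has to be kept, because then an automorphism that sends \<open>a\<close> to \<open>f a\<close> for
  all \<open>a \<in> A\<close> can be obtained from \<open>realise_shift_poset\<close>. Among the orbits that meet \<open>B\<close> all relations
  outside the ones generated by \<open>B\<close> are forgotten. With the orbits sorted upwards, each new orbit needs
  lower bounds only, namely the finitely many that come from relations within \<open>B\<close>, so \<open>shift_poset_adjoin\<close>
  applies with \<open>U = {}\<close>.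
\<close>
lemma dispersing_approximation:
  fixes f :: "'a::order \<Rightarrow> 'a"
  assumes gen: "generic_poset TYPE('a)" and f: "correctly_orbitally_incomparable f" and A: "finite A"
  obtains f' where "correctly_orbitally_incomparable f'" "dispersing f'" "\<And>a. a \<in> A \<Longrightarrow> f' a = f a"
proof -
  have fA: "f \<in> carrier Aut"
    using f by (simp add: correctly_orbitally_incomparable_def orbitally_incomparable_def)
  define B where "B = A \<union> f ` A"
  have "finite B"
    using A by (simp add: B_def)
  then obtain n :: nat and r where
    "\<forall>i j. i < j \<and> j < n \<longrightarrow> (\<forall>k::int. \<not> (f [^]\<^bsub>Aut\<^esub> k) (r j) \<le> r i)" and
    r_cover: "\<forall>b\<in>B. \<exists>i<n. \<exists>k::int. (f [^]\<^bsub>Aut\<^esub> k) (r i) = b"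
    using orbit_representatives[OF f \<open>finite B\<close>] by blast
  then have r_sorted: "\<not> (f [^]\<^bsub>Aut\<^esub> k) (r j) \<le> r i" if "i < j" "j < n" for i j and k :: int
    using that by blast
  define val :: "nat \<times> int \<Rightarrow> 'a" where "val p = (f [^]\<^bsub>Aut\<^esub> snd p) (r (fst p))" for p
  have val_shift: "val (shift k p) = (f [^]\<^bsub>Aut\<^esub> k) (val p)" for k p
    using Aut_pow_add[OF fA, of k "snd p"] by (simp add: val_def add.commute)
  have val_le: "fst p \<le> fst q" if "val p \<le> val q" "fst p < n" "fst q < n" for p q
    using that r_sorted[of "fst q" "fst p" "snd p - snd q"] Aut_pow_le_shift[OF fA]
    by (force simp: val_def)
  have val_orbit: "p = q" if "val p \<le> val q" "fst p = fst q" for p q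
    using that orbits_are_antichains[OF f, of "snd p" "r (fst p)" "snd q"] by (simp add: val_def prod_eq_iff)
  have inj: "inj_on val {p. fst p < n}"
    using val_le val_orbit by (intro inj_onI) (metis mem_Collect_eq order.antisym order.refl)
  define C where "C = {p. fst p < n \<and> val p \<in> B}"
  have "finite C"
    using finite_vimage_IntI[OF \<open>finite B\<close> inj] unfolding C_def
    by (rule finite_subset[rotated]) auto
  \<comment> \<open>The first property prevents new relations on \<open>B\<close>, the second one preserves the old ones.\<close>
  have "\<exists>S. shift_poset {..<m} S \<and> (\<forall>p q. S p q \<longrightarrow> val p \<le> val q) \<and>
      (\<forall>p q. fst p < m \<longrightarrow> fst q < m \<longrightarrow> p \<in> C \<longrightarrow> q \<in> C \<longrightarrow> val p \<le> val q \<longrightarrow> S p q)" if "m \<le> n" for m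
    using that
  proof (induction m)
    case 0
    then show ?case
      using shift_poset_empty by (intro exI[of _ "\<lambda>_ _. False"]) auto
  next
    case (Suc m)
    then obtain S where S: "shift_poset {..<m} S" and S_le: "\<And>p q. S p q \<Longrightarrow> val p \<le> val q"
      and S_C: "\<And>p q. fst p < m \<Longrightarrow> fst q < m \<Longrightarrow> p \<in> C \<Longrightarrow> q \<in> C \<Longrightarrow> val p \<le> val q \<Longrightarrow> S p q"
      by auto
    interpret shift_poset "{..<m}" S by (rule S)
    \<comment> \<open>A relation \<open>p \<le> q\<close> with \<open>q\<close> in orbit \<open>m\<close> is translated so that its upper end becomes \<open>(m, 0)\<close>.\<close>
    define L where "L = (\<lambda>(p, q). shift (- snd q) p) `
      {(p, q). p \<in> C \<and> q \<in> C \<and> fst q = m \<and> val p \<le> val q}"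
    have "finite L"
      unfolding L_def
      by (intro finite_imageI finite_subset[OF _ finite_cartesian_product[OF \<open>finite C\<close> \<open>finite C\<close>]]) auto
    have L_le: "val l \<le> val (m, 0)" if "l \<in> L" for l
    proof -
      obtain p q where l: "l = shift (- snd q) p" "fst q = m" "val p \<le> val q"
        using \<open>l \<in> L\<close> unfolding L_def by auto
      then have "val (shift (- snd q) p) \<le> val (shift (- snd q) q)"
        unfolding val_shift using Aut_pow_le_iff[OF fA] by blast
      moreover have "shift (- snd q) q = (m, 0)"
        using l(2) by (simp add: shift_def)
      ultimately show ?thesis using l(1) by simp
    qed
    let ?S = "adjoin m L {} S"
    have "shift_poset (insert m {..<m}) ?S"
      by (rule shift_poset_adjoin) (use \<open>finite L\<close> in auto)
    moreover have "insert m {..<m} = {..<Suc m}"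
      by auto
    moreover have "val p \<le> val q" if pq: "?S p q" for p q
    proof -
      have "val p \<le> val q" if "fst q = m" "l \<in> L" "S p (shift (snd q) l)" for l
      proof -
        have "val p \<le> val (shift (snd q) l)"
          using S_le that by blast
        also have "\<dots> \<le> val (shift (snd q) (m, 0))"
          unfolding val_shift using L_le[OF that(2)] Aut_pow_le_iff[OF fA] by blast
        also have "shift (snd q) (m, 0) = q"
          using that(1) by (simp add: shift_def prod_eq_iff)
        finally show ?thesis .
      qed
      then show ?thesis
        using pq S_le unfolding adjoin_def by blast
    qed
    moreover have "?S p q"
      if pq: "fst p < Suc m" "fst q < Suc m" "p \<in> C" "q \<in> C" "val p \<le> val q" for p q
    proof -
      have "fst p \<le> fst q"
        using val_le pq unfolding C_def by blast
      with pq consider "fst p < m" "fst q < m" | "fst p = fst q" "fst q = m" | "fst p < m" "fst q = m"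
        by linarith
      then show ?thesis
      proof cases
        case 1
        then show ?thesis using S_C pq by (simp add: adjoin_def)
      next
        case 2
        then show ?thesis using val_orbit pq by (simp add: adjoin_def)
      next
        case 3
        then have "shift (- snd q) p \<in> L"
          unfolding L_def using pq by (intro image_eqI[of _ _ "(p, q)"]) auto
        moreover have "S p (shift (snd q) (shift (- snd q) p))"
          using refl[of p] 3 by simp
        ultimately show ?thesis using 3 unfolding adjoin_def by blast
      qed
    qed
    ultimately show ?case by (intro exI[of _ ?S]) auto
  qed
  then obtain S where S: "shift_poset {..<n} S" and S_le: "\<And>p q. S p q \<Longrightarrow> val p \<le> val q"
    and S_C: "\<And>p q. p \<in> C \<Longrightarrow> q \<in> C \<Longrightarrow> val p \<le> val q \<Longrightarrow> S p q"
    unfolding C_def by blast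
  let ?p = "(\<lambda>p. (p, val p)) ` C"
  have p: "finite ?p" "partial_iso S (\<le>) ?p"
    using \<open>finite C\<close> S_le S_C by (auto simp: partial_iso_def)
  moreover have "fst q < n" if "(q, a) \<in> ?p" for q a
    using that by (auto simp: C_def)
  then obtain f' where f': "correctly_orbitally_incomparable f'" "dispersing f'"
    "\<And>q a b. (q, a) \<in> ?p \<Longrightarrow> (shift 1 q, b) \<in> ?p \<Longrightarrow> f' a = b"
    using realise_shift_poset[OF gen S p] by blast
  have "f' a = f a" if "a \<in> A" for a
  proof -
    have "a \<in> B" "f a \<in> B"
      using that by (auto simp: B_def)
    then obtain i k where ik: "i < n" "(f [^]\<^bsub>Aut\<^esub> (k::int)) (r i) = a"
      using r_cover by blast
    have "val (shift 1 (i, k)) = f (val (i, k))"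
      unfolding val_shift using Aut_pow_1[OF fA] by simp
    moreover have "val (i, k) = a"
      using ik by (simp add: val_def)
    ultimately have val: "a = val (i, k)" "f a = val (shift 1 (i, k))"
      by simp_all
    have "(i, k) \<in> C" "shift 1 (i, k) \<in> C"
      using ik(1) \<open>a \<in> B\<close> \<open>f a \<in> B\<close> unfolding C_def by (simp_all add: val(1)[symmetric] val(2)[symmetric])
    then have "((i, k), a) \<in> ?p" "(shift 1 (i, k), f a) \<in> ?p"
      by (intro image_eqI[of _ _ "(i, k)"] image_eqI[of _ _ "shift 1 (i, k)"]; simp add: val(1)[symmetric] val(2)[symmetric])+
    then show ?thesis by (rule f'(3))
  qed
  then show ?thesis using that f' by blast
qed


section \<open>Homogeneity and far points\<close>

lemma generic_extend_to_Aut: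
  fixes p :: "('a::order \<times> 'a) set"
  assumes gen: "generic_poset TYPE('a)" and p: "finite p" "partial_iso (\<le>) (\<le>) p"
  obtains g where "g \<in> carrier Aut" "\<And>a b. (a, b) \<in> p \<Longrightarrow> g a = b"
proof -
  have c: "countable (UNIV :: 'a set)"
    using gen by (simp add: generic_poset_def)
  note E = poset_on_order generic_poset_extension_property[OF gen] c
  obtain g where "bij g" "\<And>x y. x \<le> y \<longleftrightarrow> g x \<le> g y" "\<And>a b. (a, b) \<in> p \<Longrightarrow> g a = b"
    using back_and_forth[OF E E p] by blast
  then show ?thesis
    using that[of g] by (simp add: mem_Aut_iff)
qed

lemma generic_incomparable_point:
  assumes "generic_poset TYPE('a::order)" and "finite (F :: 'a set)"
  shows "\<exists>y. \<forall>z\<in>F. incomparable y z"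
  using generic_poset_extension_property[OF assms(1), unfolded extension_property_def, rule_format, of "{}" "{}" F]
    assms(2) by (auto simp: incomparable_def)

lemma incomparable_sym: "incomparable x y \<longleftrightarrow> incomparable y x"
  by (auto simp: incomparable_def)

lemma incomparable_irrefl [simp]: "\<not> incomparable x x"
  by (simp add: incomparable_def)

lemma Aut_incomparable_iff: "f \<in> carrier Aut \<Longrightarrow> incomparable (f x) (f y) \<longleftrightarrow> incomparable x y"
  by (simp add: incomparable_def Aut_le_iff)

lemma Aut_pow_incomparable_shift:
  assumes "f \<in> carrier Aut"
  shows "incomparable ((f [^]\<^bsub>Aut\<^esub> (k::int)) x) y \<longleftrightarrow> incomparable x ((f [^]\<^bsub>Aut\<^esub> (- k)) y)"
  using Aut_incomparable_iff[OF Aut.int_pow_closed[OF assms], of k x "(f [^]\<^bsub>Aut\<^esub> (- k)) y"]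
    Aut_pow_minus[OF assms] by simp

section \<open>Neighbourhoods of automorphisms, pairs and tuples\<close>

definition agreeing :: "'a set \<Rightarrow> ('a::order \<Rightarrow> 'a) \<Rightarrow> ('a \<Rightarrow> 'a) set" where
  "agreeing A f = {g \<in> carrier Aut. \<forall>x\<in>A. g x = f x}"

lemma agreeing_Un: "agreeing (A \<union> B) f = agreeing A f \<inter> agreeing B f"
  by (auto simp: agreeing_def)

lemma agreeing_mono: "A \<subseteq> B \<Longrightarrow> agreeing B f \<subseteq> agreeing A f"
  by (auto simp: agreeing_def)

lemma openin_agreeing:
  assumes "f \<in> carrier Aut" "finite A"
  shows "openin Aut_topology (agreeing A f)"
proof -
  have "poset_iso A (\<le>) (f ` A) (\<le>) f"
    using assms(1) Aut_eq_iff[OF assms(1)] Aut_le_iff[OF assms(1)]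
    by (auto simp: poset_iso_def bij_betw_def inj_on_def)
  then show ?thesis
    unfolding Aut_topology_def agreeing_def using assms(2)
    by (intro topology_generated_by_Basis CollectI exI[of _ A] exI[of _ "f ` A"] exI[of _ f]) simp
qed

lemma openin_Aut_topology:
  "openin Aut_topology W \<longleftrightarrow> W \<subseteq> carrier Aut \<and> (\<forall>f\<in>W. \<exists>A. finite A \<and> agreeing A f \<subseteq> W)"
proof
  assume W: "openin Aut_topology W"
  then have sub: "W \<subseteq> carrier Aut"
    using openin_subset topspace_Aut_topology by blast
  moreover have "\<exists>A. finite A \<and> agreeing A f \<subseteq> W" if f: "f \<in> W" for f
    using W[unfolded Aut_topology_def openin_topology_generated_by_iff] f
  proof (induction rule: generate_topology_on.induct)
    case Empty
    then show ?case by simp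
  next
    case (Int V W)
    then obtain A B where "finite A" "agreeing A f \<subseteq> V" "finite B" "agreeing B f \<subseteq> W"
      by blast
    then show ?case
      by (intro exI[of _ "A \<union> B"]) (auto simp: agreeing_Un)
  next
    case (UN K)
    then obtain V where V: "V \<in> K" "f \<in> V" by blast
    with UN obtain A where "finite A" "agreeing A f \<subseteq> V" by blast
    with V show ?case by blast
  next
    case (Basis V)
    then obtain A p where "finite A" "V = {g \<in> carrier Aut. \<forall>x\<in>A. g x = p x}"
      by blast
    with Basis show ?case
      by (intro exI[of _ A]) (auto simp: agreeing_def)
  qed
  ultimately show "W \<subseteq> carrier Aut \<and> (\<forall>f\<in>W. \<exists>A. finite A \<and> agreeing A f \<subseteq> W)"
    by blast
next
  assume W: "W \<subseteq> carrier Aut \<and> (\<forall>f\<in>W. \<exists>A. finite A \<and> agreeing A f \<subseteq> W)"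
  show "openin Aut_topology W"
  proof (subst openin_subopen, intro ballI)
    fix f assume "f \<in> W"
    with W obtain A where A: "finite A" "agreeing A f \<subseteq> W" "f \<in> carrier Aut" by blast
    then show "\<exists>T. openin Aut_topology T \<and> f \<in> T \<and> T \<subseteq> W"
      using openin_agreeing[OF A(3,1)] by (intro exI[of _ "agreeing A f"]) (auto simp: agreeing_def)
  qed
qed

lemma openin_Aut_pairs:
  assumes X: "X \<subseteq> carrier Aut"
  shows "openin (prod_topology (subtopology Aut_topology X) Aut_topology) W \<longleftrightarrow>
    W \<subseteq> X \<times> carrier Aut \<and>
    (\<forall>(f, g)\<in>W. \<exists>A. finite A \<and> (agreeing A f \<inter> X) \<times> agreeing A g \<subseteq> W)" (is "?open \<longleftrightarrow> ?nbhd")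
proof
  assume W: ?open
  have "W \<subseteq> X \<times> carrier Aut"
    using openin_subset[OF W] X by (auto simp: topspace_Aut_topology)
  moreover have "\<exists>A. finite A \<and> (agreeing A f \<inter> X) \<times> agreeing A g \<subseteq> W" if fg: "(f, g) \<in> W" for f g
  proof -
    obtain U V where UV: "openin (subtopology Aut_topology X) U" "openin Aut_topology V" "f \<in> U" "g \<in> V" "U \<times> V \<subseteq> W"
      using W[unfolded openin_prod_topology_alt, rule_format, OF fg] by blast
    obtain U' where U': "openin Aut_topology U'" "U = U' \<inter> X"
      using UV(1) unfolding openin_subtopology by blast
    obtain A where "finite A" "agreeing A f \<subseteq> U'"
      using U' UV(3) unfolding openin_Aut_topology by blast
    moreover obtain B where "finite B" "agreeing B g \<subseteq> V"
      using UV(2,4) unfolding openin_Aut_topology by blast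
    ultimately show ?thesis
      using UV(5) U'(2) by (intro exI[of _ "A \<union> B"]) (auto simp: agreeing_Un)
  qed
  ultimately show ?nbhd by blast
next
  assume W: ?nbhd
  show ?open
    unfolding openin_prod_topology_alt
  proof (intro allI impI)
    fix f g assume fg: "(f, g) \<in> W"
    with W obtain A where A: "finite A" "(agreeing A f \<inter> X) \<times> agreeing A g \<subseteq> W" and
      mem: "f \<in> X" "f \<in> carrier Aut" "g \<in> carrier Aut"
      using X by blast
    have "openin (subtopology Aut_topology X) (agreeing A f \<inter> X)"
      using openin_agreeing[OF mem(2) A(1)] by (rule openin_subtopology_Int)
    moreover have "openin Aut_topology (agreeing A g)"
      by (rule openin_agreeing[OF mem(3) A(1)])
    ultimately show "\<exists>U V. openin (subtopology Aut_topology X) U \<and> openin Aut_topology V \<and> f \<in> U \<and> g \<in> V \<and> U \<times> V \<subseteq> W"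
      using A(2) mem by (intro exI[of _ "agreeing A f \<inter> X"] exI[of _ "agreeing A g"]) (auto simp: agreeing_def)
  qed
qed

lemma openin_Aut_tuples:
  "openin (tuple_topology m Aut_topology) W \<longleftrightarrow>
    W \<subseteq> {..<m} \<rightarrow>\<^sub>E carrier Aut \<and>
    (\<forall>gs\<in>W. \<exists>A. finite A \<and> ({..<m} \<rightarrow>\<^sub>E carrier Aut) \<inter> {hs. \<forall>i<m. hs i \<in> agreeing A (gs i)} \<subseteq> W)"
  (is "?open \<longleftrightarrow> ?nbhd")
proof
  assume W: ?open
  have "W \<subseteq> {..<m} \<rightarrow>\<^sub>E carrier Aut"
    using openin_subset[OF W] by (simp add: tuple_topology_def topspace_Aut_topology)
  moreover have "\<exists>A. finite A \<and> ({..<m} \<rightarrow>\<^sub>E carrier Aut) \<inter> {hs. \<forall>i<m. hs i \<in> agreeing A (gs i)} \<subseteq> W"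
    if gs: "gs \<in> W" for gs
  proof -
    obtain U where U: "\<forall>i\<in>{..<m}. openin Aut_topology (U i)" "gs \<in> Pi\<^sub>E {..<m} U" "Pi\<^sub>E {..<m} U \<subseteq> W"
      using W[unfolded tuple_topology_def openin_product_topology_alt, rule_format, OF gs] by blast
    then have "\<forall>i\<in>{..<m}. \<exists>A. finite A \<and> agreeing A (gs i) \<subseteq> U i"
      unfolding openin_Aut_topology by blast
    then obtain A where A: "\<forall>i\<in>{..<m}. finite (A i) \<and> agreeing (A i) (gs i) \<subseteq> U i"
      by (rule bchoice[THEN exE])
    have PiE_U: "hs \<in> Pi\<^sub>E {..<m} U" if hs: "hs \<in> {..<m} \<rightarrow>\<^sub>E carrier Aut" "\<forall>i<m. hs i \<in> agreeing (\<Union>i<m. A i) (gs i)" for hs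
    proof (rule PiE_I)
      fix i assume "i \<in> {..<m}"
      then have "hs i \<in> agreeing (A i) (gs i)"
        using that(2) agreeing_mono[of "A i" "\<Union>i<m. A i" "gs i"] by blast
      then show "hs i \<in> U i" using A \<open>i \<in> {..<m}\<close> by blast
    qed (use that(1) in auto)
    have "({..<m} \<rightarrow>\<^sub>E carrier Aut) \<inter> {hs. \<forall>i<m. hs i \<in> agreeing (\<Union>i<m. A i) (gs i)} \<subseteq> W"
    proof
      fix hs assume "hs \<in> ({..<m} \<rightarrow>\<^sub>E carrier Aut) \<inter> {hs. \<forall>i<m. hs i \<in> agreeing (\<Union>i<m. A i) (gs i)}"
      then have "hs \<in> Pi\<^sub>E {..<m} U"
        by (intro PiE_U) simp_all
      with U(3) show "hs \<in> W" ..
    qed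
    moreover have "finite (\<Union>i<m. A i)"
      using A by simp
    ultimately show ?thesis by (intro exI[of _ "\<Union>i<m. A i"] conjI)
  qed
  ultimately show ?nbhd by (intro conjI ballI)
next
  assume W: ?nbhd
  show ?open
    unfolding tuple_topology_def openin_product_topology_alt
  proof (intro ballI)
    fix gs assume "gs \<in> W"
    with W obtain A where A: "finite A"
      "({..<m} \<rightarrow>\<^sub>E carrier Aut) \<inter> {hs. \<forall>i<m. hs i \<in> agreeing A (gs i)} \<subseteq> W" and gs: "gs \<in> {..<m} \<rightarrow>\<^sub>E carrier Aut"
      by blast
    have gsA: "gs i \<in> carrier Aut" if "i < m" for i
      using gs that by auto
    show "\<exists>U. finite {i \<in> {..<m}. U i \<noteq> topspace Aut_topology} \<and> (\<forall>i\<in>{..<m}. openin Aut_topology (U i)) \<and>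
        gs \<in> Pi\<^sub>E {..<m} U \<and> Pi\<^sub>E {..<m} U \<subseteq> W"
    proof (intro exI[of _ "\<lambda>i. agreeing A (gs i)"] conjI)
      show "\<forall>i\<in>{..<m}. openin Aut_topology (agreeing A (gs i))"
        using openin_agreeing gsA A(1) by blast
      show "gs \<in> (\<Pi>\<^sub>E i\<in>{..<m}. agreeing A (gs i))"
        using gs by (auto simp: agreeing_def PiE_iff)
      have "(\<Pi>\<^sub>E i\<in>{..<m}. agreeing A (gs i)) \<subseteq> ({..<m} \<rightarrow>\<^sub>E carrier Aut) \<inter> {hs. \<forall>i<m. hs i \<in> agreeing A (gs i)}"
        by (auto simp: agreeing_def PiE_iff)
      then show "(\<Pi>\<^sub>E i\<in>{..<m}. agreeing A (gs i)) \<subseteq> W"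
        using A(2) by (rule subset_trans)
    qed simp
  qed
qed

section \<open>Comeager sets and words\<close>

text \<open>
  The definition of comeager asks that the complement be equal to a union of nowhere dense sets, so the
  complements of the dense open sets are cut down by \<open>S\<close>.
\<close>
lemma comeager_in_countable_Inter:
  assumes S: "S \<subseteq> topspace T" and "countable \<U>"
    and "open": "\<And>U. U \<in> \<U> \<Longrightarrow> openin T U"
    and dense: "\<And>U. U \<in> \<U> \<Longrightarrow> T closure_of U = topspace T"
    and sub: "topspace T \<inter> \<Inter>\<U> \<subseteq> S"
  shows "comeager_in T S"
  unfolding comeager_in_def
proof (intro conjI S exI ballI)
  let ?N = "(\<lambda>U. (topspace T - U) - S) ` \<U>"
  show "countable ?N"
    using \<open>countable \<U>\<close> by simp
  show "topspace T - S = \<Union> ?N"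
    using sub by blast
  fix N assume "N \<in> ?N"
  then obtain U where U: "U \<in> \<U>" "N = (topspace T - U) - S" by blast
  have "T closure_of N \<subseteq> topspace T - U"
    using "open"[OF U(1)] U(2) by (intro closure_of_minimal) auto
  then have "T interior_of (T closure_of N) \<subseteq> T interior_of (topspace T - U)"
    by (rule interior_of_mono)
  also have "\<dots> = {}"
    using dense[OF U(1)] by (simp add: interior_of_complement)
  finally show "nowhere_dense_in T N"
    using U(2) by (auto simp: nowhere_dense_in_def)
qed

text \<open>
  Continuity of powers, evaluated at a point: the value depends only on the restriction of \<open>f\<close> to a finite
  part of the orbit.
\<close>
lemma Aut_pow_locally_determined:
  assumes f: "f \<in> carrier Aut"
  shows "\<exists>A. finite A \<and> (\<forall>f'\<in>agreeing A f. (f' [^]\<^bsub>Aut\<^esub> (k::int)) x = (f [^]\<^bsub>Aut\<^esub> k) x)"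
proof (induction k rule: int_induct[of _ 0])
  case base
  then show ?case by auto
next
  case (step1 k)
  then obtain A where A: "finite A" "\<forall>f'\<in>agreeing A f. (f' [^]\<^bsub>Aut\<^esub> k) x = (f [^]\<^bsub>Aut\<^esub> k) x"
    by blast
  have "(f' [^]\<^bsub>Aut\<^esub> (k + 1)) x = (f [^]\<^bsub>Aut\<^esub> (k + 1)) x"
    if "f' \<in> agreeing (insert ((f [^]\<^bsub>Aut\<^esub> k) x) A) f" for f'
    using that A(2) Aut_pow_add[of f' 1 k x] Aut_pow_add[OF f, of 1 k x] Aut_pow_1[OF f]
    by (auto simp: agreeing_def add.commute)
  then show ?case
    using A(1) by (intro exI[of _ "insert ((f [^]\<^bsub>Aut\<^esub> k) x) A"]) auto
next
  case (step2 k)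
  then obtain A where A: "finite A" "\<forall>f'\<in>agreeing A f. (f' [^]\<^bsub>Aut\<^esub> k) x = (f [^]\<^bsub>Aut\<^esub> k) x"
    by blast
  \<comment> \<open>For a step backwards it is the value at the target that has to be fixed: it determines the preimage.\<close>
  let ?y = "(f [^]\<^bsub>Aut\<^esub> (k - 1)) x"
  have "(f' [^]\<^bsub>Aut\<^esub> (k - 1)) x = ?y" if f': "f' \<in> agreeing (insert ?y A) f" for f'
  proof -
    have f'A: "f' \<in> carrier Aut" "f' \<in> agreeing A f" "f' ?y = f ?y"
      using f' by (auto simp: agreeing_def)
    have "f' ((f' [^]\<^bsub>Aut\<^esub> (k - 1)) x) = f ?y"
      using A(2) f'A Aut_pow_add[of f' 1 "k - 1" x] Aut_pow_add[OF f, of 1 "k - 1" x] Aut_pow_1[OF f]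
        Aut_pow_1[of f'] by simp
    then show ?thesis
      using f'A Aut_eq_iff by metis
  qed
  then show ?case
    using A(1) by (intro exI[of _ "insert ?y A"]) auto
qed

lemma word_value_Nil [simp]: "word_value Aut f g [] = id"
  and word_value_Cons [simp]: "word_value Aut f g ((c, n) # w) =
    (letter_value f g c [^]\<^bsub>Aut\<^esub> n) \<circ> word_value Aut f g w"
  by (simp_all add: word_value_def)

lemma word_value_locally_determined:
  assumes f: "f \<in> carrier Aut" and g: "g \<in> carrier Aut"
  shows "\<exists>A. finite A \<and> (\<forall>f'\<in>agreeing A f. \<forall>g'\<in>agreeing A g.
    word_value Aut f' g' w x = word_value Aut f g w x)"
proof (induction w)
  case Nil
  then show ?case by auto
next
  case (Cons s w)
  obtain c n where s: "s = (c, n)" by force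
  obtain A where A: "finite A" "\<forall>f'\<in>agreeing A f. \<forall>g'\<in>agreeing A g.
    word_value Aut f' g' w x = word_value Aut f g w x"
    using Cons by blast
  have "\<exists>B. finite B \<and> (\<forall>f'\<in>agreeing B f. \<forall>g'\<in>agreeing B g.
      (letter_value f' g' c [^]\<^bsub>Aut\<^esub> n) y = (letter_value f g c [^]\<^bsub>Aut\<^esub> n) y)" for y
    using Aut_pow_locally_determined[OF f, of n y] Aut_pow_locally_determined[OF g, of n y]
    by (cases c) auto
  then obtain B where B: "finite B" "\<forall>f'\<in>agreeing B f. \<forall>g'\<in>agreeing B g.
      (letter_value f' g' c [^]\<^bsub>Aut\<^esub> n) (word_value Aut f g w x) =
      (letter_value f g c [^]\<^bsub>Aut\<^esub> n) (word_value Aut f g w x)"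
    by blast
  show ?case
    using A B by (intro exI[of _ "A \<union> B"]) (simp add: s agreeing_Un)
qed


section \<open>Conjugating an extension onto a given finite map\<close>

lemma dispersing_displaces:
  assumes f: "dispersing f" and B: "finite B"
  shows "\<exists>k::int. \<forall>b\<in>B. \<forall>c\<in>B. incomparable ((f [^]\<^bsub>Aut\<^esub> k) b) c"
proof -
  have fA: "f \<in> carrier Aut"
    using f by (simp add: dispersing_def)
  define bad where "bad b c = {k::int. (f [^]\<^bsub>Aut\<^esub> k) b \<le> c} \<union> uminus ` {k::int. (f [^]\<^bsub>Aut\<^esub> k) c \<le> b}" for b c
  have "finite (\<Union>b\<in>B. \<Union>c\<in>B. bad b c)"
    using f B by (simp add: bad_def dispersing_def)
  then obtain k where k: "k \<notin> (\<Union>b\<in>B. \<Union>c\<in>B. bad b c)"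
    using ex_new_if_finite[OF infinite_UNIV_int] by blast
  have "incomparable ((f [^]\<^bsub>Aut\<^esub> k) b) c" if "b \<in> B" "c \<in> B" for b c
  proof -
    have "k \<notin> bad b c"
      using k that by blast
    moreover have "c \<le> (f [^]\<^bsub>Aut\<^esub> k) b \<longleftrightarrow> (f [^]\<^bsub>Aut\<^esub> (- k)) c \<le> b"
      using Aut_pow_le_shift[OF fA, of 0 c k b] by simp
    ultimately show ?thesis
      unfolding bad_def incomparable_def by (force simp: image_iff)
  qed
  then show ?thesis by blast
qed

text \<open>
  The finite map to be extended is \<open>g\<close> on \<open>A\<close> together with \<open>h\<close> on \<open>B\<close> conjugated by \<open>f\<^sup>k\<close>. The displacement makes
  every point of one part incomparable to every point of the other, in the domain and in the range.
\<close>
lemma extend_with_conjugate: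
  fixes f g h :: "'a::order \<Rightarrow> 'a"
  assumes gen: "generic_poset TYPE('a)"
    and Aut: "f \<in> carrier Aut" "g \<in> carrier Aut" "h \<in> carrier Aut"
    and fin: "finite A" "finite B"
    and D: "A \<union> g ` A \<union> B \<union> h ` B \<subseteq> D"
    and k: "\<forall>b\<in>D. \<forall>c\<in>D. incomparable ((f [^]\<^bsub>Aut\<^esub> (k::int)) b) c"
  shows "\<exists>g'\<in>agreeing A g. \<forall>b\<in>B. (f [^]\<^bsub>Aut\<^esub> (- k)) (g' ((f [^]\<^bsub>Aut\<^esub> k) b)) = h b"
proof -
  let ?F = "f [^]\<^bsub>Aut\<^esub> k"
  let ?p = "(\<lambda>a. (a, g a)) ` A \<union> (\<lambda>b. (?F b, ?F (h b))) ` B"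
  have far: "\<not> a \<le> ?F b" "\<not> ?F b \<le> a" "\<not> g a \<le> ?F (h b)" "\<not> ?F (h b) \<le> g a" if "a \<in> A" "b \<in> B" for a b
  proof -
    have "a \<in> D" "b \<in> D" "g a \<in> D" "h b \<in> D"
      using that D by blast+
    then show "\<not> a \<le> ?F b" "\<not> ?F b \<le> a" "\<not> g a \<le> ?F (h b)" "\<not> ?F (h b) \<le> g a"
      using k unfolding incomparable_def by blast+
  qed
  have "finite ?p"
    using fin by simp
  moreover have "partial_iso (\<le>) (\<le>) ?p"
    using far Aut_le_iff[OF Aut(2)] Aut_le_iff[OF Aut(3)] Aut_pow_le_iff[OF Aut(1)]
    by (auto simp: partial_iso_def)
  ultimately obtain g' where g': "g' \<in> carrier Aut" "\<And>a b. (a, b) \<in> ?p \<Longrightarrow> g' a = b"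
    using generic_extend_to_Aut[OF gen] by blast
  have "g' \<in> agreeing A g"
    using g' by (auto simp: agreeing_def)
  moreover have "(f [^]\<^bsub>Aut\<^esub> (- k)) (g' (?F b)) = h b" if "b \<in> B" for b
    using g'(2)[of "?F b" "?F (h b)"] that Aut_pow_minus[OF Aut(1)] by auto
  ultimately show ?thesis by blast
qed

section \<open>Irreducible words take non-trivial values\<close>

definition antichain :: "'a::order set \<Rightarrow> bool" where
  "antichain V \<longleftrightarrow> (\<forall>x\<in>V. \<forall>y\<in>V. x \<noteq> y \<longrightarrow> incomparable x y)"

text \<open>
  \<open>E\<close> is the set of \<open>g\<close>-steps and \<open>V\<close> the set of points visited so far. Since \<open>V\<close> is an antichain that is
  incomparable to \<open>C\<close>, injectivity is all that is needed for \<open>E\<close> to be a partial isomorphism, even jointly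
  with any partial isomorphism between subsets of \<open>C\<close>.
\<close>
definition free_path :: "'a::order set \<Rightarrow> ('a \<times> 'a) set \<Rightarrow> 'a set \<Rightarrow> bool" where
  "free_path C E V \<longleftrightarrow> finite V \<and> Field E \<subseteq> V \<and>
     (\<forall>a b a' b'. (a, b) \<in> E \<longrightarrow> (a', b') \<in> E \<longrightarrow> (a = a' \<longleftrightarrow> b = b')) \<and>
     antichain V \<and> (\<forall>x\<in>V. \<forall>c\<in>C. incomparable x c)"

lemma free_path_converse: "free_path C (E\<inverse>) V \<longleftrightarrow> free_path C E V"
  unfolding free_path_def Field_converse converse_iff by blast

lemma free_path_insert_point:
  assumes "free_path C E V" "\<And>z. z \<in> V \<union> C \<Longrightarrow> incomparable y z"
  shows "free_path C E (insert y V)"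
  using assms incomparable_sym[of y] unfolding free_path_def antichain_def by auto

lemma free_path_insert_edge:
  assumes E: "free_path C E V" and x: "x \<in> V" "x \<notin> Domain E" and y: "y \<in> V" "y \<notin> Range E"
  shows "free_path C (insert (x, y) E) V"
proof -
  have "Field (insert (x, y) E) \<subseteq> V"
    using E x(1) y(1) by (auto simp: free_path_def)
  moreover have "a = a' \<longleftrightarrow> b = b'" if "(a, b) \<in> insert (x, y) E" "(a', b') \<in> insert (x, y) E" for a b a' b'
    using E x(2) y(2) that unfolding free_path_def by blast
  ultimately show ?thesis
    using E unfolding free_path_def by blast
qed

text \<open>
  A condition on a translate of \<open>y\<close> is one on \<open>y\<close> itself with the other point translated back, so all the
  conditions together ask for incomparability with a single finite set.
\<close>
lemma far_point:
  fixes f :: "'a::order \<Rightarrow> 'a"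
  assumes gen: "generic_poset TYPE('a)" and f: "f \<in> carrier Aut" and fin: "finite F" "finite N"
  shows "\<exists>y. \<forall>z\<in>F. incomparable y z \<and> (\<forall>m\<in>N. incomparable ((f [^]\<^bsub>Aut\<^esub> (m::int)) y) z)"
proof -
  have "finite (F \<union> (\<Union>m\<in>N. (f [^]\<^bsub>Aut\<^esub> (- m)) ` F))"
    using fin by simp
  from generic_incomparable_point[OF gen this]
  obtain y where y: "\<forall>z\<in>F \<union> (\<Union>m\<in>N. (f [^]\<^bsub>Aut\<^esub> (- m)) ` F). incomparable y z"
    by blast
  show ?thesis
  proof (intro exI ballI conjI)
    fix z m assume "z \<in> F" "m \<in> N"
    then show "incomparable ((f [^]\<^bsub>Aut\<^esub> m) y) z"
      using y unfolding Aut_pow_incomparable_shift[OF f] by blast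
  qed (use y in blast)
qed

definition extends :: "('a \<times> 'a) set \<Rightarrow> ('a::order \<Rightarrow> 'a) \<Rightarrow> bool" where
  "extends E g \<longleftrightarrow> g \<in> carrier Aut \<and> (\<forall>a b. (a, b) \<in> E \<longrightarrow> g a = b)"

text \<open>
  Powers of \<open>g\<close> are followed through fresh points. The set \<open>N\<close> contains the exponents of \<open>f\<close> that may be applied
  next: the end point is chosen so that its translates by them avoid the path as well. For the end point
  itself this is orbital incomparability of \<open>f\<close>.
\<close>
lemma free_path_iterate_pos:
  fixes f :: "'a::order \<Rightarrow> 'a" and N :: "int set"
  assumes gen: "generic_poset TYPE('a)" and f: "orbitally_incomparable f" and C: "finite C" and N: "finite N" "0 \<notin> N"
    and E: "free_path C E V" "x \<in> V" "x \<notin> Domain E"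
  shows "\<exists>E' V' y. free_path C E' V' \<and> E \<subseteq> E' \<and> V \<subseteq> V' \<and> y \<in> V' - V \<and> y \<notin> Domain E' \<and>
    (\<forall>g. extends E' g \<longrightarrow> (g [^]\<^bsub>Aut\<^esub> int (Suc k)) x = y) \<and>
    (\<forall>m\<in>N. \<forall>z\<in>V' \<union> C. incomparable ((f [^]\<^bsub>Aut\<^esub> m) y) z)"
proof -
  have fA: "f \<in> carrier Aut"
    using f by (simp add: orbitally_incomparable_def)
  have step: "\<exists>y. y \<notin> V \<and> y \<notin> Domain (insert (x, y) E) \<and> free_path C (insert (x, y) E) (insert y V) \<and>
      (\<forall>m\<in>N. \<forall>z\<in>insert y V \<union> C. incomparable ((f [^]\<^bsub>Aut\<^esub> m) y) z)"
    if E: "free_path C E V" and x: "x \<in> V" "x \<notin> Domain E" for E V x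
  proof -
    have "finite (V \<union> C)"
      using E C by (simp add: free_path_def)
    from far_point[OF gen fA this N(1)]
    obtain y where y: "\<And>z. z \<in> V \<union> C \<Longrightarrow> incomparable y z"
      "\<And>z m. z \<in> V \<union> C \<Longrightarrow> m \<in> N \<Longrightarrow> incomparable ((f [^]\<^bsub>Aut\<^esub> m) y) z"
      by blast
    have yV: "y \<notin> V"
      using y(1)[of y] by auto
    then have yE: "y \<notin> Field E"
      using E by (auto simp: free_path_def)
    have "free_path C (insert (x, y) E) (insert y V)"
      using E y(1) x yE
      by (intro free_path_insert_edge free_path_insert_point) (auto simp: Field_def)
    moreover have "incomparable ((f [^]\<^bsub>Aut\<^esub> m) y) y" if "m \<in> N" for m
      using f that N(2) unfolding orbitally_incomparable_def by metis
    ultimately show ?thesis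
      using y yV yE x by (intro exI[of _ y]) (auto simp: Field_def)
  qed
  show ?thesis
  proof (induction k)
    case 0
    obtain y where y: "y \<notin> V" "y \<notin> Domain (insert (x, y) E)" "free_path C (insert (x, y) E) (insert y V)"
      "\<forall>m\<in>N. \<forall>z\<in>insert y V \<union> C. incomparable ((f [^]\<^bsub>Aut\<^esub> m) y) z"
      using step[OF E] by blast
    moreover have "(g [^]\<^bsub>Aut\<^esub> int (Suc 0)) x = y" if "extends (insert (x, y) E) g" for g
      using that Aut_pow_1[of g] by (auto simp: extends_def)
    ultimately show ?case
      by (intro exI[of _ "insert (x, y) E"] exI[of _ "insert y V"] exI[of _ y]) blast
  next
    case (Suc k)
    then obtain E1 V1 u where 1: "free_path C E1 V1" "E \<subseteq> E1" "V \<subseteq> V1" "u \<in> V1 - V" "u \<notin> Domain E1"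
      and u: "\<And>g. extends E1 g \<Longrightarrow> (g [^]\<^bsub>Aut\<^esub> int (Suc k)) x = u"
      by blast
    obtain y where y: "y \<notin> V1" "y \<notin> Domain (insert (u, y) E1)" "free_path C (insert (u, y) E1) (insert y V1)"
      "\<forall>m\<in>N. \<forall>z\<in>insert y V1 \<union> C. incomparable ((f [^]\<^bsub>Aut\<^esub> m) y) z"
      using step[of E1 V1 u] 1 by blast
    moreover have "(g [^]\<^bsub>Aut\<^esub> int (Suc (Suc k))) x = y" if "extends (insert (u, y) E1) g" for g
    proof -
      have g: "g \<in> carrier Aut" "extends E1 g" "g u = y"
        using that by (auto simp: extends_def)
      have "int (Suc (Suc k)) = 1 + int (Suc k)"
        by simp
      then have "(g [^]\<^bsub>Aut\<^esub> int (Suc (Suc k))) x = (g [^]\<^bsub>Aut\<^esub> (1::int)) ((g [^]\<^bsub>Aut\<^esub> int (Suc k)) x)"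
        using Aut_pow_add[OF g(1), of 1 "int (Suc k)" x] by metis
      also have "\<dots> = y"
        unfolding u[OF g(2)] Aut_pow_1[OF g(1)] by (rule g(3))
      finally show ?thesis .
    qed
    ultimately show ?case
      using 1 by (intro exI[of _ "insert (u, y) E1"] exI[of _ "insert y V1"] exI[of _ y]) blast
  qed
qed

text \<open>
  For negative exponents the path is built for the inverse of \<open>g\<close>, with all steps reversed.
\<close>
lemma free_path_iterate:
  fixes f :: "'a::order \<Rightarrow> 'a" and n :: int and N :: "int set"
  assumes gen: "generic_poset TYPE('a)" and f: "orbitally_incomparable f" and C: "finite C" and N: "finite N" "0 \<notin> N"
    and E: "free_path C E V" "x \<in> V" "x \<notin> Field E" and n: "n \<noteq> 0"
  shows "\<exists>E' V' y. free_path C E' V' \<and> E \<subseteq> E' \<and> V \<subseteq> V' \<and> y \<in> V' - V \<and>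
    (\<forall>g. extends E' g \<longrightarrow> (g [^]\<^bsub>Aut\<^esub> n) x = y) \<and>
    (\<forall>m\<in>N. \<forall>z\<in>V' \<union> C. incomparable ((f [^]\<^bsub>Aut\<^esub> m) y) z)"
proof (cases "n > 0")
  case True
  then have "n = int (Suc (nat n - 1))"
    by simp
  moreover have "x \<notin> Domain E"
    using E(3) by (auto simp: Field_def)
  ultimately show ?thesis
    using free_path_iterate_pos[OF gen f C N E(1,2), of "nat n - 1"] by metis
next
  case False
  then have n': "n = - int (Suc (nat (- n) - 1))"
    using n by simp
  have E': "free_path C (E\<inverse>) V" "x \<notin> Domain (E\<inverse>)"
    using E by (auto simp: free_path_converse Field_def)
  obtain E1 V1 y where 1: "free_path C E1 V1" "E\<inverse> \<subseteq> E1" "V \<subseteq> V1" "y \<in> V1 - V"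
    "\<forall>m\<in>N. \<forall>z\<in>V1 \<union> C. incomparable ((f [^]\<^bsub>Aut\<^esub> m) y) z"
    and y: "\<And>g. extends E1 g \<Longrightarrow> (g [^]\<^bsub>Aut\<^esub> int (Suc (nat (- n) - 1))) x = y"
    using free_path_iterate_pos[OF gen f C N E'(1) E(2) E'(2), of "nat (- n) - 1"] by blast
  have "(g [^]\<^bsub>Aut\<^esub> n) x = y" if g: "extends (E1\<inverse>) g" for g
  proof -
    have gA: "g \<in> carrier Aut"
      using g by (simp add: extends_def)
    have "(g [^]\<^bsub>Aut\<^esub> (-1::int)) a = b" if "(a, b) \<in> E1" for a b
    proof -
      have "g b = a"
        using g that by (simp add: extends_def)
      then show ?thesis
        using Aut_pow_minus(1)[OF gA, of 1 b] Aut_pow_1[OF gA] by simp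
    qed
    then have "extends E1 (g [^]\<^bsub>Aut\<^esub> (-1::int))"
      using Aut.int_pow_closed[OF gA] unfolding extends_def by blast
    from y[OF this] show ?thesis
      unfolding Aut.int_pow_pow[OF gA] using n' by simp
  qed
  moreover have "free_path C (E1\<inverse>) V1" "E \<subseteq> E1\<inverse>"
    using 1 by (auto simp: free_path_converse)
  ultimately show ?thesis
    using 1 by (intro exI[of _ "E1\<inverse>"] exI[of _ V1] exI[of _ y]) blast
qed

text \<open>
  The word is evaluated from the right. The two implications are what the next letter needs: a power of \<open>g\<close> can
  only be prescribed at a point where no step starts or ends yet, and a power of \<open>f\<close> must lead to a point
  that is incomparable to the whole path. Irreducibility ensures that powers of \<open>f\<close> and \<open>g\<close> alternate, so
  that the letter read last provides the condition. In particular each new end point is different from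
  the starting point.
\<close>
lemma free_path_word:
  fixes f :: "'a::order \<Rightarrow> 'a"
  assumes gen: "generic_poset TYPE('a)" and f: "orbitally_incomparable f" and C: "finite C"
  shows "\<lbrakk>\<forall>(c, n)\<in>set w. n \<noteq> 0; distinct_adj (map fst w); finite N; 0 \<notin> N\<rbrakk> \<Longrightarrow>
    \<exists>E V x0 x. free_path C E V \<and> x0 \<in> V \<and> x \<in> V \<and> (w \<noteq> [] \<longrightarrow> x \<noteq> x0) \<and>
      (\<forall>g. extends E g \<longrightarrow> word_value Aut f g w x0 = x) \<and>
      ((w = [] \<or> fst (hd w) = Letter_a) \<longrightarrow> x \<notin> Field E) \<and>
      ((w = [] \<or> fst (hd w) = Letter_b) \<longrightarrow>
        (\<forall>m\<in>N. \<forall>z\<in>V \<union> C. incomparable ((f [^]\<^bsub>Aut\<^esub> (m::int)) x) z))"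
proof (induction w arbitrary: N)
  case Nil
  have fA: "f \<in> carrier Aut"
    using f by (simp add: orbitally_incomparable_def)
  obtain y where y: "\<And>z. z \<in> C \<Longrightarrow> incomparable y z"
    "\<And>z m. z \<in> C \<Longrightarrow> m \<in> N \<Longrightarrow> incomparable ((f [^]\<^bsub>Aut\<^esub> m) y) z"
    using far_point[OF gen fA C Nil(3)] by blast
  have "free_path C {} {y}"
    using y by (auto simp: free_path_def antichain_def)
  moreover have "incomparable ((f [^]\<^bsub>Aut\<^esub> m) y) y" if "m \<in> N" for m
    using f that Nil(4) unfolding orbitally_incomparable_def by metis
  ultimately show ?case
    using y by (intro exI[of _ "{}"] exI[of _ "{y}"] exI[of _ y]) auto
next
  case (Cons s w)
  obtain c n where s: "s = (c, n)" by force
  have w: "\<forall>(c, n)\<in>set w. n \<noteq> 0" "distinct_adj (map fst w)" "n \<noteq> 0"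
    and hd: "w = [] \<or> fst (hd w) \<noteq> c"
    using Cons.prems by (auto simp: s distinct_adj_Cons hd_map)
  have fA: "f \<in> carrier Aut"
    using f by (simp add: orbitally_incomparable_def)
  show ?case
  proof (cases c)
    case Letter_a
    then have "w = [] \<or> fst (hd w) = Letter_b"
      using hd by (metis letter.exhaust)
    moreover obtain E V x0 x where E: "free_path C E V" "x0 \<in> V" "x \<in> V"
      "\<forall>g. extends E g \<longrightarrow> word_value Aut f g w x0 = x"
      "(w = [] \<or> fst (hd w) = Letter_b) \<longrightarrow>
        (\<forall>m\<in>{n}. \<forall>z\<in>V \<union> C. incomparable ((f [^]\<^bsub>Aut\<^esub> (m::int)) x) z)"
    proof -
      have "finite {n}" "0 \<notin> {n}"
        using w(3) by auto
      from Cons.IH[OF w(1,2) this] show ?thesis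
        by (elim exE conjE) (rule that)
    qed
    ultimately have far: "\<And>z. z \<in> V \<union> C \<Longrightarrow> incomparable ((f [^]\<^bsub>Aut\<^esub> n) x) z"
      by blast
    let ?y = "(f [^]\<^bsub>Aut\<^esub> n) x"
    have "?y \<notin> V"
      using far[of ?y] by auto
    moreover have "free_path C E (insert ?y V)"
      by (rule free_path_insert_point[OF E(1) far])
    moreover have "Field E \<subseteq> V"
      using E(1) by (simp add: free_path_def)
    ultimately show ?thesis
      using E(2,4) Letter_a
      by (intro exI[of _ E] exI[of _ "insert ?y V"] exI[of _ x0] exI[of _ ?y]) (auto simp: s)
  next
    case Letter_b
    then have "w = [] \<or> fst (hd w) = Letter_a"
      using hd by (metis letter.exhaust)
    moreover obtain E V x0 x where E: "free_path C E V" "x0 \<in> V" "x \<in> V"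
      "\<forall>g. extends E g \<longrightarrow> word_value Aut f g w x0 = x"
      "(w = [] \<or> fst (hd w) = Letter_a) \<longrightarrow> x \<notin> Field E"
    proof -
      have "finite {}" "(0::int) \<notin> {}"
        by auto
      from Cons.IH[OF w(1,2) this] show ?thesis
        by (elim exE conjE) (rule that)
    qed
    ultimately obtain E' V' y where E': "free_path C E' V'" "E \<subseteq> E'" "V \<subseteq> V'" "y \<in> V' - V"
      "\<And>g. extends E' g \<Longrightarrow> (g [^]\<^bsub>Aut\<^esub> n) x = y"
      "\<forall>m\<in>N. \<forall>z\<in>V' \<union> C. incomparable ((f [^]\<^bsub>Aut\<^esub> m) y) z"
      using free_path_iterate[OF gen f C Cons.prems(3,4) E(1,3) _ w(3)] by blast
    have "word_value Aut f g (s # w) x0 = y" if "extends E' g" for g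
    proof -
      have "extends E g"
        using that E'(2) unfolding extends_def by blast
      then show ?thesis
        using E(4) E'(5)[OF that] by (simp add: s Letter_b)
    qed
    then show ?thesis
      using E(2) E'(1,3,4,6) Letter_b
      by (intro exI[of _ E'] exI[of _ V'] exI[of _ x0] exI[of _ y]) (auto simp: s)
  qed
qed

text \<open>
  The steps of the path are added to the restriction of \<open>g\<close> to \<open>A\<close>; the path stays incomparable to \<open>A\<close> and to its
  image, so the result is a partial isomorphism.
\<close>
lemma generic_word_nontrivial:
  fixes f g :: "'a::order \<Rightarrow> 'a"
  assumes gen: "generic_poset TYPE('a)" and f: "orbitally_incomparable f" and g: "g \<in> carrier Aut"
    and A: "finite A" and w: "irreducible_word w"
  shows "\<exists>g'\<in>agreeing A g. word_value Aut f g' w \<noteq> id"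
proof -
  let ?C = "A \<union> g ` A"
  obtain E V x0 x where E: "free_path ?C E V" "x \<noteq> x0"
    "\<And>g. extends E g \<Longrightarrow> word_value Aut f g w x0 = x"
    using free_path_word[OF gen f, of ?C w "{}"] A w unfolding irreducible_word_def by auto
  let ?p = "E \<union> (\<lambda>a. (a, g a)) ` A"
  have "E \<subseteq> V \<times> V" "finite V"
    using E(1) by (auto simp: free_path_def Field_def)
  then have "finite E"
    using finite_subset by blast
  then have "finite ?p"
    using A by simp
  moreover have "partial_iso (\<le>) (\<le>) ?p"
  proof -
    have inV: "a \<in> V" "b \<in> V" if "(a, b) \<in> E" for a b
      using that \<open>E \<subseteq> V \<times> V\<close> by auto
    have V: "u \<le> v \<longleftrightarrow> u = v" if "u \<in> V" "v \<in> V" for u v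
      using E(1) that unfolding free_path_def antichain_def incomparable_def by (metis order.refl)
    have C: "\<not> u \<le> c" "\<not> c \<le> u" if "u \<in> V" "c \<in> ?C" for u c
      using E(1) that unfolding free_path_def incomparable_def by blast+
    have "a \<le> a' \<longleftrightarrow> b \<le> b'" if "(a, b) \<in> E" "(a', b') \<in> E" for a b a' b'
      using V[of a a'] V[of b b'] inV[OF that(1)] inV[OF that(2)] E(1) that unfolding free_path_def by blast
    moreover have "\<not> a \<le> c" "\<not> c \<le> a" "\<not> b \<le> g c" "\<not> g c \<le> b" if "(a, b) \<in> E" "c \<in> A" for a b c
      using C[of a c] C[of b "g c"] inV[OF that(1)] that(2) by auto
    ultimately show ?thesis
      using Aut_le_iff[OF g] by (auto simp: partial_iso_def)
  qed
  ultimately obtain g' where g': "g' \<in> carrier Aut" "\<And>a b. (a, b) \<in> ?p \<Longrightarrow> g' a = b"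
    using generic_extend_to_Aut[OF gen] by blast
  have "g' \<in> agreeing A g" "extends E g'"
    using g' by (auto simp: agreeing_def extends_def)
  then show ?thesis
    using E(2,3) by (metis id_apply)
qed

lemma countable_words: "countable (UNIV :: (letter \<times> int) list set)"
proof -
  have "UNIV = {Letter_a, Letter_b}"
    using letter.exhaust by auto
  then have "countable (UNIV :: letter set)"
    by (metis countable_finite finite.emptyI finite.insertI)
  then have "countable (UNIV \<times> UNIV :: (letter \<times> int) set)"
    by (intro countable_SIGMA) auto
  then show ?thesis
    using countable_lists[of "UNIV :: (letter \<times> int) set"] by simp
qed


section \<open>The comeager sets\<close>

lemma dense_Aut_pairs:
  fixes X :: "('a::order \<Rightarrow> 'a) set" and W :: "(('a \<Rightarrow> 'a) \<times> ('a \<Rightarrow> 'a)) set"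
  assumes X: "X \<subseteq> carrier Aut"
    and W: "\<And>f g A. f \<in> X \<Longrightarrow> g \<in> carrier Aut \<Longrightarrow> finite A \<Longrightarrow>
      \<exists>f'\<in>agreeing A f \<inter> X. \<exists>g'\<in>agreeing A g. (f', g') \<in> W"
  shows "prod_topology (subtopology Aut_topology X) Aut_topology closure_of W =
    topspace (prod_topology (subtopology Aut_topology X) Aut_topology)"
  unfolding dense_intersects_open
proof (intro allI impI, elim conjE)
  fix V :: "(('a \<Rightarrow> 'a) \<times> ('a \<Rightarrow> 'a)) set"
  assume V: "openin (prod_topology (subtopology Aut_topology X) Aut_topology) V" "V \<noteq> {}"
  then obtain f g where fg: "(f, g) \<in> V" by auto
  with V(1) obtain A where A: "finite A" "(agreeing A f \<inter> X) \<times> agreeing A g \<subseteq> V" "f \<in> X" "g \<in> carrier Aut"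
    unfolding openin_Aut_pairs[OF X] by blast
  from W[OF A(3,4,1)] A(2) show "W \<inter> V \<noteq> {}"
    by blast
qed

lemma dense_Aut_tuples:
  fixes W :: "(nat \<Rightarrow> 'a::order \<Rightarrow> 'a) set"
  assumes W: "\<And>gs A. gs \<in> {..<m} \<rightarrow>\<^sub>E carrier Aut \<Longrightarrow> finite A \<Longrightarrow>
      \<exists>hs\<in>W \<inter> ({..<m} \<rightarrow>\<^sub>E carrier Aut). \<forall>i<m. hs i \<in> agreeing A (gs i)"
  shows "tuple_topology m Aut_topology closure_of W = topspace (tuple_topology m Aut_topology)"
  unfolding dense_intersects_open
proof (intro allI impI, elim conjE)
  fix V :: "(nat \<Rightarrow> 'a \<Rightarrow> 'a) set"
  assume V: "openin (tuple_topology m Aut_topology) V" "V \<noteq> {}"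
  then obtain gs where gs: "gs \<in> V" by auto
  have "V \<subseteq> {..<m} \<rightarrow>\<^sub>E carrier Aut"
    using V(1) unfolding openin_Aut_tuples by (rule conjunct1)
  moreover obtain A where A: "finite A"
    "({..<m} \<rightarrow>\<^sub>E carrier Aut) \<inter> {hs. \<forall>i<m. hs i \<in> agreeing A (gs i)} \<subseteq> V"
    using V(1)[unfolded openin_Aut_tuples, THEN conjunct2, rule_format, OF gs] by (elim exE conjE)
  ultimately have "\<exists>hs\<in>W \<inter> ({..<m} \<rightarrow>\<^sub>E carrier Aut). \<forall>i<m. hs i \<in> agreeing A (gs i)"
    using gs by (intro W) (rule subsetD)
  then obtain hs where "hs \<in> W" "hs \<in> {..<m} \<rightarrow>\<^sub>E carrier Aut" "\<forall>i<m. hs i \<in> agreeing A (gs i)"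
    by (elim bexE IntE)
  then have "hs \<in> W \<inter> V"
    using A(2) by (intro IntI subsetD[OF A(2)]) simp_all
  then show "W \<inter> V \<noteq> {}"
    by blast
qed

lemma topspace_tuple_topology: "topspace (tuple_topology m Aut_topology) = {..<m} \<rightarrow>\<^sub>E carrier Aut"
  by (simp add: tuple_topology_def topspace_Aut_topology)

lemma countable_finite_sets: "countable (UNIV :: 'a set) \<Longrightarrow> countable {r :: 'a set. finite r}"
  using countable_Fpow[of UNIV] by (simp add: Fpow_def)

text \<open>
  The dense open conditions are \<open>w(f, g) \<noteq> id\<close>, one for each irreducible word, and "some conjugate of \<open>g\<close> by a
  power of \<open>f\<close> extends \<open>r\<close>", one for each finite part \<open>r\<close> of an automorphism. For the former it suffices to
  change \<open>g\<close>; for the latter \<open>f\<close> is first replaced by a dispersing automorphism nearby.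
\<close>
theorem comeager_freely_generating_pairs:
  fixes X :: "('a::order \<Rightarrow> 'a) set"
  assumes gen: "generic_poset TYPE('a)" and X: "X = {f. correctly_orbitally_incomparable f}"
  shows "comeager_in (prod_topology (subtopology Aut_topology X) Aut_topology)
           {(f, g) \<in> X \<times> carrier Aut. freely_generate_dense_subgroup Aut Aut_topology f g}"
proof (rule comeager_in_countable_Inter)
  let ?P = "prod_topology (subtopology Aut_topology X) (Aut_topology :: ('a \<Rightarrow> 'a) topology)"
  have Xoi: "orbitally_incomparable f" "f \<in> carrier Aut" if "f \<in> X" for f
    using that by (auto simp: X correctly_orbitally_incomparable_def orbitally_incomparable_def)
  then have XA: "X \<subseteq> carrier Aut"
    by blast
  have top: "topspace ?P = X \<times> carrier Aut"
    using XA by (auto simp: topspace_Aut_topology)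
  define conj where "conj k = [(Letter_a, - k), (Letter_b, 1), (Letter_a, k)]" for k :: int
  define Vw where "Vw w = {(f, g) \<in> X \<times> carrier Aut. word_value Aut f g w \<noteq> id}" for w
  define Vr where "Vr r = {(f, g) \<in> X \<times> carrier Aut. \<exists>k. \<forall>(x, y)\<in>r. word_value Aut f g (conj k) x = y}"
    for r :: "('a \<times> 'a) set"
  define \<R> where "\<R> = {r :: ('a \<times> 'a) set. finite r \<and> (\<exists>h\<in>carrier Aut. \<forall>(x, y)\<in>r. h x = y)}"
  let ?\<U> = "Vw ` {w. irreducible_word w} \<union> Vr ` \<R>"
  have conj: "word_value Aut f g (conj k) x = (f [^]\<^bsub>Aut\<^esub> (- k)) (g ((f [^]\<^bsub>Aut\<^esub> k) x))"
    if "g \<in> carrier Aut" for f g k x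
    using that by (simp add: conj_def Aut_pow_1 del: Aut.int_pow_neg)
  show "{(f, g) \<in> X \<times> carrier Aut. freely_generate_dense_subgroup Aut Aut_topology f g} \<subseteq> topspace ?P"
    unfolding top by blast
  show "countable ?\<U>"
  proof -
    have "countable (UNIV :: 'a set)"
      using gen by (simp add: generic_poset_def)
    then have "countable (UNIV \<times> UNIV :: ('a \<times> 'a) set)"
      by (intro countable_SIGMA) auto
    then have "countable \<R>"
      by (intro countable_subset[OF _ countable_finite_sets]) (auto simp: \<R>_def)
    then show ?thesis
      using countable_subset[OF subset_UNIV countable_words] by blast
  qed
  show "openin ?P U" if "U \<in> ?\<U>" for U
    using that
  proof (elim UnE imageE)
    fix w assume U: "U = Vw w"
    show ?thesis
      unfolding openin_Aut_pairs[OF XA] U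
    proof (intro conjI ballI, goal_cases)
      case 1
      show ?case by (auto simp: Vw_def)
    next
      case (2 fg)
      obtain f g where fg: "fg = (f, g)" by force
      with 2 have f: "f \<in> carrier Aut" and g: "g \<in> carrier Aut" and "word_value Aut f g w \<noteq> id"
        using Xoi by (auto simp: Vw_def)
      then obtain x where "word_value Aut f g w x \<noteq> x"
        by (auto simp: fun_eq_iff)
      moreover obtain A where A: "finite A" "\<forall>f'\<in>agreeing A f. \<forall>g'\<in>agreeing A g.
          word_value Aut f' g' w x = word_value Aut f g w x"
        using word_value_locally_determined[OF f g] by blast
      ultimately have "(agreeing A f \<inter> X) \<times> agreeing A g \<subseteq> Vw w"
        by (auto simp: Vw_def agreeing_def) (metis id_apply)
      with A(1) show ?case
        unfolding fg by auto
    qed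
  next
    fix r assume U: "U = Vr r" and r: "r \<in> \<R>"
    show ?thesis
      unfolding openin_Aut_pairs[OF XA] U
    proof (intro conjI ballI, goal_cases)
      case 1
      show ?case by (auto simp: Vr_def)
    next
      case (2 fg)
      obtain f g where fg: "fg = (f, g)" by force
      with 2 obtain k where f: "f \<in> carrier Aut" and g: "g \<in> carrier Aut"
        and k: "\<forall>(x, y)\<in>r. word_value Aut f g (conj k) x = y"
        using Xoi by (auto simp: Vr_def)
      obtain A where A: "\<And>x. finite (A x)" "\<And>x f' g'. f' \<in> agreeing (A x) f \<Longrightarrow> g' \<in> agreeing (A x) g \<Longrightarrow>
          word_value Aut f' g' (conj k) x = word_value Aut f g (conj k) x"
        using word_value_locally_determined[OF f g] by metis
      let ?A = "\<Union>(x, y)\<in>r. A x"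
      have "(agreeing ?A f \<inter> X) \<times> agreeing ?A g \<subseteq> Vr r"
      proof (rule subrelI)
        fix f' g' assume fg': "(f', g') \<in> (agreeing ?A f \<inter> X) \<times> agreeing ?A g"
        have "word_value Aut f' g' (conj k) x = y" if "(x, y) \<in> r" for x y
        proof -
          have "A x \<subseteq> ?A"
            using that by blast
          then have "f' \<in> agreeing (A x) f" "g' \<in> agreeing (A x) g"
            using fg' agreeing_mono by blast+
          then show ?thesis
            using A(2) k that by fastforce
        qed
        moreover have "f' \<in> X" "g' \<in> carrier Aut"
          using fg' by (auto simp: agreeing_def)
        ultimately show "(f', g') \<in> Vr r"
          unfolding Vr_def by blast
      qed
      moreover have "finite ?A"
        using r A(1) by (auto simp: \<R>_def)
      ultimately show ?case
        unfolding fg by auto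
    qed
  qed
  show "?P closure_of U = topspace ?P" if "U \<in> ?\<U>" for U
    using that
  proof (elim UnE imageE CollectE)
    fix w assume U: "U = Vw w" and w: "irreducible_word w"
    show ?thesis
    proof (rule dense_Aut_pairs[OF XA])
      fix f g :: "'a \<Rightarrow> 'a" and A :: "'a set"
      assume f: "f \<in> X" and g: "g \<in> carrier Aut" and A: "finite A"
      obtain g' where "g' \<in> agreeing A g" "word_value Aut f g' w \<noteq> id"
        using generic_word_nontrivial[OF gen Xoi(1)[OF f] g A w] by blast
      moreover have "f \<in> agreeing A f \<inter> X"
        using f Xoi by (auto simp: agreeing_def)
      moreover have "g' \<in> carrier Aut" if "g' \<in> agreeing A g" for g'
        using that by (simp add: agreeing_def)
      ultimately show "\<exists>f'\<in>agreeing A f \<inter> X. \<exists>g'\<in>agreeing A g. (f', g') \<in> U"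
        unfolding U Vw_def using f by blast
    qed
  next
    fix r assume U: "U = Vr r" and "r \<in> \<R>"
    then obtain h where r: "finite r" and h: "h \<in> carrier Aut" "\<forall>(x, y)\<in>r. h x = y"
      by (auto simp: \<R>_def)
    show ?thesis
    proof (rule dense_Aut_pairs[OF XA])
      fix f g :: "'a \<Rightarrow> 'a" and A :: "'a set"
      assume f: "f \<in> X" and g: "g \<in> carrier Aut" and A: "finite A"
      let ?B = "fst ` r"
      obtain f' where f': "correctly_orbitally_incomparable f'" "dispersing f'" "\<And>a. a \<in> A \<Longrightarrow> f' a = f a"
        using dispersing_approximation[OF gen, of f A] f A X by blast
      have f'A: "f' \<in> carrier Aut"
        using f'(2) by (simp add: dispersing_def)
      have "finite (A \<union> g ` A \<union> ?B \<union> h ` ?B)" (is "finite ?D")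
        using A r by simp
      from dispersing_displaces[OF f'(2) this] obtain k :: int where
        k: "\<forall>b\<in>?D. \<forall>c\<in>?D. incomparable ((f' [^]\<^bsub>Aut\<^esub> k) b) c"
        by (rule exE)
      obtain g' where g': "g' \<in> agreeing A g"
        "\<forall>b\<in>?B. (f' [^]\<^bsub>Aut\<^esub> (- k)) (g' ((f' [^]\<^bsub>Aut\<^esub> k) b)) = h b"
        using extend_with_conjugate[OF gen f'A g h(1) A finite_imageI[OF r] order.refl k] by blast
      have g'A: "g' \<in> carrier Aut"
        using g'(1) by (simp add: agreeing_def)
      have "word_value Aut f' g' (conj k) x = y" if "(x, y) \<in> r" for x y
      proof -
        have "x \<in> ?B"
          using that by force
        then show ?thesis
          using g'(2) h(2) that unfolding conj[OF g'A] by auto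
      qed
      then have "(f', g') \<in> Vr r"
        unfolding Vr_def using f'(1) g'A X by blast
      moreover have "f' \<in> agreeing A f \<inter> X"
        using f'(1,3) f'A X by (auto simp: agreeing_def)
      ultimately show "\<exists>f'\<in>agreeing A f \<inter> X. \<exists>g'\<in>agreeing A g. (f', g') \<in> U"
        unfolding U using g'(1) by blast
    qed
  qed
  show "topspace ?P \<inter> \<Inter>?\<U> \<subseteq> {(f, g) \<in> X \<times> carrier Aut. freely_generate_dense_subgroup Aut Aut_topology f g}"
  proof (rule subrelI)
    fix f g assume fg: "(f, g) \<in> topspace ?P \<inter> \<Inter>?\<U>"
    then have f: "f \<in> X" "f \<in> carrier Aut" and g: "g \<in> carrier Aut"
      unfolding top using XA by blast+
    have free: "word_value Aut f g w \<noteq> \<one>\<^bsub>Aut\<^esub>" if "irreducible_word w" for w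
    proof -
      have "(f, g) \<in> Vw w"
        using fg that by blast
      then show ?thesis by (simp add: Vw_def)
    qed
    let ?G = "generate Aut {f, g}"
    have sub: "subgroup ?G Aut"
      using f g by (intro Aut.generate_is_subgroup) auto
    have mem: "f \<in> ?G" "g \<in> ?G"
      by (auto intro: generate.incl)
    have word: "word_value Aut f g w \<in> ?G" for w
    proof (induction w)
      case Nil
      then show ?case
        unfolding word_value_Nil Aut_one[symmetric] by (intro subgroup.one_closed[OF sub])
    next
      case (Cons s w)
      obtain c n where s: "s = (c, n)" by force
      have "letter_value f g c [^]\<^bsub>Aut\<^esub> n \<in> ?G"
        using mem by (cases c) (auto intro: Aut.subgroup_int_pow_closed[OF sub])
      then show ?case
        unfolding s word_value_Cons Aut_mult[symmetric] by (rule subgroup.m_closed[OF sub _ Cons])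
    qed
    have "Aut_topology closure_of ?G = topspace Aut_topology"
      unfolding dense_intersects_open
    proof (intro allI impI, elim conjE)
      fix V assume V: "openin Aut_topology V" "V \<noteq> ({} :: ('a \<Rightarrow> 'a) set)"
      then obtain h A where h: "h \<in> V" "h \<in> carrier Aut" and A: "finite A" "agreeing A h \<subseteq> V"
        unfolding openin_Aut_topology by blast
      let ?r = "(\<lambda>a. (a, h a)) ` A"
      have "?r \<in> \<R>"
        using A(1) h(2) by (auto simp: \<R>_def)
      then have "(f, g) \<in> Vr ?r"
        using fg by blast
      then obtain k where k: "\<And>a. a \<in> A \<Longrightarrow> word_value Aut f g (conj k) a = h a"
        by (auto simp: Vr_def)
      have "word_value Aut f g (conj k) \<in> carrier Aut"
        using word subgroup.subset[OF sub] by blast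
      with k have "word_value Aut f g (conj k) \<in> agreeing A h"
        by (simp add: agreeing_def)
      then show "?G \<inter> V \<noteq> {}"
        using A(2) word by blast
    qed
    with free f(1) g show "(f, g) \<in> {(f, g) \<in> X \<times> carrier Aut. freely_generate_dense_subgroup Aut Aut_topology f g}"
      by (simp add: freely_generate_dense_subgroup_def)
  qed
qed

text \<open>
  One dispersing \<open>f\<close> serves all tuples. For each finite part \<open>r\<close> of a tuple of automorphisms, written as a set of
  triples (index, argument, value), the tuples that some power of \<open>f\<close> conjugates onto an extension of \<open>r\<close>
  form a dense open set: a common exponent exists because the finite sets of all coordinates can be
  displaced at once.
\<close>
theorem comeager_cyclically_dense:
  assumes gen: "generic_poset TYPE('a::order)"
  shows "comeager_in (tuple_topology m (Aut_topology :: ('a \<Rightarrow> 'a) topology))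
    {gs. cyclically_dense Aut Aut_topology m gs}"
proof -
  let ?T = "tuple_topology m (Aut_topology :: ('a \<Rightarrow> 'a) topology)"
  let ?\<Omega> = "{..<m} \<rightarrow>\<^sub>E (carrier Aut :: ('a \<Rightarrow> 'a) set)"
  obtain f :: "'a \<Rightarrow> 'a" where f: "dispersing f"
    using exists_dispersing[OF gen] by blast
  then have fA: "f \<in> carrier Aut"
    by (simp add: dispersing_def)
  define V where "V r = {gs \<in> ?\<Omega>. \<exists>k::int. \<forall>(i, x, y)\<in>r.
      (f [^]\<^bsub>Aut\<^esub> (- k)) (gs i ((f [^]\<^bsub>Aut\<^esub> k) x)) = y}" for r
  define \<R> where "\<R> = {r :: (nat \<times> 'a \<times> 'a) set. finite r \<and> (\<exists>hs\<in>?\<Omega>. \<forall>(i, x, y)\<in>r. i < m \<and> hs i x = y)}"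
  show ?thesis
  proof (rule comeager_in_countable_Inter)
    show "{gs. cyclically_dense Aut Aut_topology m gs} \<subseteq> topspace ?T"
      by (auto simp: topspace_tuple_topology cyclically_dense_def)
    show "countable (V ` \<R>)"
    proof -
      have "countable (UNIV :: 'a set)"
        using gen by (simp add: generic_poset_def)
      then have "countable (UNIV \<times> UNIV \<times> UNIV :: (nat \<times> 'a \<times> 'a) set)"
        by (intro countable_SIGMA) auto
      then have "countable \<R>"
        by (intro countable_subset[OF _ countable_finite_sets]) (auto simp: \<R>_def)
      then show ?thesis by simp
    qed
    show "openin ?T U" if UV: "U \<in> V ` \<R>" for U
    proof -
      obtain r where U: "U = V r" and r: "r \<in> \<R>"
        using UV by blast
      have "\<exists>A. finite A \<and> ?\<Omega> \<inter> {hs. \<forall>i<m. hs i \<in> agreeing A (gs i)} \<subseteq> V r" if gs: "gs \<in> V r" for gs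
      proof -
        obtain k :: int where k: "\<forall>(i, x, y)\<in>r. (f [^]\<^bsub>Aut\<^esub> (- k)) (gs i ((f [^]\<^bsub>Aut\<^esub> k) x)) = y"
          using gs by (auto simp: V_def)
        let ?A = "(\<lambda>(i, x, y). (f [^]\<^bsub>Aut\<^esub> k) x) ` r"
        have "hs \<in> V r" if hs: "hs \<in> ?\<Omega>" "\<forall>i<m. hs i \<in> agreeing ?A (gs i)" for hs
        proof -
          have "(f [^]\<^bsub>Aut\<^esub> (- k)) (hs i ((f [^]\<^bsub>Aut\<^esub> k) x)) = y" if "(i, x, y) \<in> r" for i x y
          proof -
            have "i < m" "(f [^]\<^bsub>Aut\<^esub> k) x \<in> ?A"
              using r that by (force simp: \<R>_def)+
            then have "hs i ((f [^]\<^bsub>Aut\<^esub> k) x) = gs i ((f [^]\<^bsub>Aut\<^esub> k) x)"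
              using hs(2) unfolding agreeing_def by blast
            then show ?thesis using k that by fastforce
          qed
          then show ?thesis
            unfolding V_def using hs(1) by blast
        qed
        then have "?\<Omega> \<inter> {hs. \<forall>i<m. hs i \<in> agreeing ?A (gs i)} \<subseteq> V r"
          by (intro subsetI) simp
        moreover have "finite ?A"
          using r by (simp add: \<R>_def)
        ultimately show ?thesis
          by (intro exI[of _ ?A] conjI)
      qed
      moreover have "V r \<subseteq> ?\<Omega>"
        by (auto simp: V_def)
      ultimately show ?thesis
        unfolding openin_Aut_tuples U by (intro conjI ballI)
    qed
    show "?T closure_of U = topspace ?T" if UV: "U \<in> V ` \<R>" for U
    proof -
      obtain r where U: "U = V r" and "r \<in> \<R>"
        using UV by blast
      then obtain hs where r: "finite r" and hs: "hs \<in> ?\<Omega>" and rhs: "\<forall>(i, x, y)\<in>r. i < m \<and> hs i x = y"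
        unfolding \<R>_def by blast
      show ?thesis
      proof (rule dense_Aut_tuples)
        fix gs and A :: "'a set" assume gs: "gs \<in> ?\<Omega>" and A: "finite A"
        let ?B = "(\<lambda>(i, x, y). x) ` r"
        let ?C = "A \<union> ?B \<union> (\<Union>i<m. gs i ` A \<union> hs i ` ?B)"
        have "finite ?C"
          using A r by simp
        from dispersing_displaces[OF f this] obtain k :: int where
          k: "\<forall>b\<in>?C. \<forall>c\<in>?C. incomparable ((f [^]\<^bsub>Aut\<^esub> k) b) c"
          by (rule exE)
        have "\<exists>g'\<in>agreeing A (gs i). \<forall>b\<in>?B. (f [^]\<^bsub>Aut\<^esub> (- k)) (g' ((f [^]\<^bsub>Aut\<^esub> k) b)) = hs i b" if "i < m" for i
        proof -
          have "gs i \<in> carrier Aut" "hs i \<in> carrier Aut"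
            using gs hs that by auto
          moreover have "finite ?B"
            using r by simp
          moreover have "A \<union> gs i ` A \<union> ?B \<union> hs i ` ?B \<subseteq> ?C"
            using that by blast
          ultimately show ?thesis
            by (intro extend_with_conjugate[OF gen fA _ _ A _ _ k])
        qed
        then obtain g' where g': "\<And>i. i < m \<Longrightarrow> g' i \<in> agreeing A (gs i)"
          "\<And>i b. i < m \<Longrightarrow> b \<in> ?B \<Longrightarrow> (f [^]\<^bsub>Aut\<^esub> (- k)) (g' i ((f [^]\<^bsub>Aut\<^esub> k) b)) = hs i b"
          by metis
        let ?g = "restrict g' {..<m}"
        have "?g \<in> ?\<Omega>"
          using g'(1) by (auto simp: agreeing_def)
        moreover have "(f [^]\<^bsub>Aut\<^esub> (- k)) (?g i ((f [^]\<^bsub>Aut\<^esub> k) x)) = y" if "(i, x, y) \<in> r" for i x y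
        proof -
          have "i < m" "hs i x = y" "x \<in> ?B"
            using rhs that by force+
          then show ?thesis using g'(2) by simp
        qed
        ultimately have "?g \<in> V r"
          unfolding V_def by blast
        then show "\<exists>hs\<in>U \<inter> ?\<Omega>. \<forall>i<m. hs i \<in> agreeing A (gs i)"
          unfolding U using \<open>?g \<in> ?\<Omega>\<close> g'(1) by (intro bexI[of _ ?g]) auto
      qed
    qed
    show "topspace ?T \<inter> \<Inter>(V ` \<R>) \<subseteq> {gs. cyclically_dense Aut Aut_topology m gs}"
    proof
      fix gs assume gs_all: "gs \<in> topspace ?T \<inter> \<Inter>(V ` \<R>)"
      then have gs: "gs \<in> ?\<Omega>"
        by (simp add: topspace_tuple_topology)
      let ?c = "\<lambda>k::int. \<lambda>i\<in>{..<m}. f [^]\<^bsub>Aut\<^esub> k \<otimes>\<^bsub>Aut\<^esub> gs i \<otimes>\<^bsub>Aut\<^esub> f [^]\<^bsub>Aut\<^esub> (- k)"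
      have "?T closure_of range ?c = topspace ?T"
      proof (rule dense_Aut_tuples)
        fix hs and A :: "'a set" assume hs: "hs \<in> ?\<Omega>" and A: "finite A"
        let ?r = "(\<lambda>(i, x). (i, x, hs i x)) ` ({..<m} \<times> A)"
        have "?r \<in> \<R>"
          using hs A unfolding \<R>_def by auto
        then have "gs \<in> V ?r"
          using gs_all by blast
        then obtain k :: int where k: "\<And>i x. i < m \<Longrightarrow> x \<in> A \<Longrightarrow> (f [^]\<^bsub>Aut\<^esub> (- k)) (gs i ((f [^]\<^bsub>Aut\<^esub> k) x)) = hs i x"
          by (auto simp: V_def)
        have gsi: "gs i \<in> carrier Aut" if "i < m" for i
          using gs that by auto
        have cA: "f [^]\<^bsub>Aut\<^esub> (- k) \<otimes>\<^bsub>Aut\<^esub> gs i \<otimes>\<^bsub>Aut\<^esub> f [^]\<^bsub>Aut\<^esub> (- (- k)) \<in> carrier Aut" if "i < m" for i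
          using gsi[OF that] fA by (intro Aut.m_closed Aut.int_pow_closed)
        have "?c (- k) \<in> ?\<Omega>"
          using cA by (intro restrict_PiE_iff[THEN iffD2]) blast
        moreover have "?c (- k) i \<in> agreeing A (hs i)" if "i < m" for i
          using cA[OF that] k[OF that] that by (simp add: agreeing_def)
        ultimately show "\<exists>gs'\<in>range ?c \<inter> ?\<Omega>. \<forall>i<m. gs' i \<in> agreeing A (hs i)"
          by (intro bexI[of _ "?c (- k)"]) blast+
      qed
      then show "gs \<in> {gs. cyclically_dense Aut Aut_topology m gs}"
        using gs fA unfolding cyclically_dense_def by blast
    qed
  qed
qed

theorem corollary6p14:
  fixes X :: "('a::order \<Rightarrow> 'a) set"
  assumes "generic_poset TYPE('a)"
    and "X = {f. correctly_orbitally_incomparable f}"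
  shows "comeager_in (prod_topology (subtopology Aut_topology X) Aut_topology)
           {(f, g) \<in> X \<times> carrier Aut. freely_generate_dense_subgroup Aut Aut_topology f g}
       \<and> (\<forall>m\<ge>1. comeager_in (tuple_topology m (Aut_topology :: ('a \<Rightarrow> 'a) topology))
                   {gs. cyclically_dense Aut Aut_topology m gs})"
  using comeager_freely_generating_pairs[OF assms] comeager_cyclically_dense[OF assms(1)] by blast

end
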